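(* Let $q\ge2$ be an integer and let $(X_\sigma)_{\sigma\in\mathbb{F}_q^+}$ be a branching-type stationary stochastic process on $\mathbb{F}_q^+$ with spectral measure $\mu_X$. Let $\alpha:\mathbb{N}\to\mathbb{C}$ be the corresponding $q$-hyper-positive definite function, i.e. $\alpha(k)=\widehat{\mu_X}(k)$ for $k\in\mathbb{N}$, so that for all $\sigma,\delta\in\mathbb{F}_q^+$ the covariance $\mathbb{E}(X_\sigma\overline{X_\delta})$ equals $\alpha(|w|)$ if $\delta=\sigma w$, $\overline{\alpha(|w|)}$ if $\sigma=\delta w$ (for some $w\in\mathbb{F}_q^+$), and $0$ otherwise. Let $\nu_\alpha$ be the unique positive Radon measure on $\mathbb{T}$ with $$\widehat{\nu_\alpha}(n)=q^{n/2}\alpha(n),\qquad n\in\mathbb{N},$$ and write its Lebesgue decomposition $d\nu_\alpha(\theta)=w_\alpha(\theta)\,dm(\theta)+d\nu_\alpha^{s}(\theta)$, where $m$ is the normalized Haar measure on $\mathbb{T}$ and $\nu_\alpha^s$ is singular with respect to $m$. Then $$d_{L^2}\left(X_e,\ \overline{\mathrm{span}}^{L^2}\big\{X_\sigma:\sigma\in\mathbb{F}_q^+\setminus\{e\}\big\}\right)=\exp\left(\frac12\int_{\mathbb{T}}\log w_\alpha(\theta)\,dm(\theta)\right).$$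
   Context: $\mathbb{N}=\{0,1,2,\dots\}$, $\mathbb{T}=\mathbb{R}/2\pi\mathbb{Z}$, $\widehat{\nu}(n)=\int_{\mathbb{T}}e^{-in\theta}d\nu(\theta)$, $\exp(-\infty)=0$. $\mathbb{F}_q^+$ is the unital free semigroup on generators $s_1,\dots,s_q$ with neutral element $e$ and word length $|\cdot|$; it is identified with the rooted $q$-homogeneous tree $T_q$ (root $e$, the children of $\sigma$ being $\sigma s_1,\dots,\sigma s_q$). Two elements $\sigma,\delta$ are comparable if $\delta=\sigma w$ or $\sigma=\delta w$ for some $w\in\mathbb{F}_q^+$. A rooted geodesic ray is an infinite sequence $\xi=(\sigma_n)_{n\in\mathbb{N}}$ with $\sigma_0=e$ and each $\sigma_{n+1}$ a child of $\sigma_n$, identified with $\mathbb{N}$. For mean-zero complex random variables, $\mathrm{Cov}(X,Y)=\mathbb{E}(X\overline{Y})$. A mean-zero square-integrable process $(X_n)_{n\in\mathbb{N}}$ is (weakly) stationary if $\mathrm{Cov}(X_n,X_{n+k})$ does not depend on $n$; its spectral measure is the unique positive Radon measure $\nu$ on $\mathbb{T}$ with $\mathrm{Cov}(X_n,X_{n+k})=\widehat{\nu}(k)$ for all $n,k\in\mathbb{N}$. A mean-zero square-integrable process $(X_\sigma)_{\sigma\in\mathbb{F}_q^+}$ is a branching-type stationary stochastic process if (i) its restriction to every rooted geodesic ray is stationary; (ii) all these restrictions share the same spectral measure, denoted $\mu_X$; (iii) $\mathrm{Cov}(X_\sigma,X_\tau)=0$ for all non-comparable $\sigma,\tau$. A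 function $\alpha:\mathbb{N}\to\mathbb{C}$ is $q$-hyper-positive definite if $\alpha(k)=\widehat{\mu_X}(k)$ $(k\in\mathbb{N})$ for some such process; for every such $\alpha$ the positive measure $\nu_\alpha$ above exists and is unique. $d_{L^2}$ denotes the distance in the $L^2$ space of the underlying probability space, and $\overline{\mathrm{span}}^{L^2}$ the closed linear span there. *)

theory Defs
  imports "HOL-Probability.Probability" "HOL-Library.Sublist"
begin

section \<open>Measures on the torus\<close>

text \<open>
  The torus is represented by its fundamental domain \<open>{0..<2 * pi}\<close>, whose Borel sets are exactly
  those of the quotient of the reals by \<open>2 * pi\<close> times the integers.  As the torus is a compact metric
  space, its positive Radon measures are its finite Borel measures.
\<close>

definition torus_measure :: "real measure \<Rightarrow> bool" where
  "torus_measure \<nu> \<longleftrightarrow>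
     finite_measure \<nu> \<and> sets \<nu> = sets (restrict_space borel {0..<2 * pi})"

definition torus_haar :: "real measure" where
  "torus_haar = restrict_space (uniform_measure lborel {0..<2 * pi}) {0..<2 * pi}"

definition fourier_coeff :: "real measure \<Rightarrow> int \<Rightarrow> complex" where
  "fourier_coeff \<nu> n = (\<integral>\<theta>. exp (- \<i> * of_int n * of_real \<theta>) \<partial>\<nu>)"

definition mutually_singular :: "'a measure \<Rightarrow> 'a measure \<Rightarrow> bool" where
  "mutually_singular \<mu> \<nu> \<longleftrightarrow>
     (\<exists>N \<in> sets \<mu>. emeasure \<mu> N = 0 \<and> emeasure \<nu> (space \<mu> - N) = 0)"

definition lebesgue_decomposition ::
    "real measure \<Rightarrow> (real \<Rightarrow> real) \<Rightarrow> real measure \<Rightarrow> bool" where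
  "lebesgue_decomposition \<nu> w \<nu>s \<longleftrightarrow>
     w \<in> borel_measurable torus_haar \<and> (AE \<theta> in torus_haar. 0 \<le> w \<theta>) \<and>
     torus_measure \<nu>s \<and> mutually_singular torus_haar \<nu>s \<and>
     (\<forall>A \<in> sets \<nu>. emeasure \<nu> A =
        emeasure (density torus_haar (\<lambda>\<theta>. ennreal (w \<theta>))) A + emeasure \<nu>s A)"

section \<open>Logarithmic integrals with values in the extended reals\<close>

text \<open>
  The logarithmic integral of the density may be minus infinity, so the integral of an extended real
  function is the integral of its positive part minus that of its negative part; \<open>e2ennreal\<close> sends
  negative arguments to 0.  For an integrable nonnegative density the first of these is finite.
\<close>

definition log_ereal :: "real \<Rightarrow> ereal" where
  "log_ereal x = (if 0 < x then ereal (ln x) else -\<infinity>)"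

fun exp_ereal :: "ereal \<Rightarrow> ereal" where
  "exp_ereal (ereal x) = ereal (exp x)"
| "exp_ereal PInfty = \<infinity>"
| "exp_ereal MInfty = 0"

definition ereal_integral :: "'a measure \<Rightarrow> ('a \<Rightarrow> ereal) \<Rightarrow> ereal" where
  "ereal_integral M f =
     enn2ereal (\<integral>\<^sup>+x. e2ennreal (f x) \<partial>M) - enn2ereal (\<integral>\<^sup>+x. e2ennreal (- f x) \<partial>M)"

section \<open>Square-integrable complex random variables\<close>

text \<open>
  Elements of the \<open>L\<^sup>2\<close> space are represented by functions rather than by classes modulo almost
  everywhere equality.
\<close>

definition L2_carrier :: "'a measure \<Rightarrow> ('a \<Rightarrow> complex) set" where
  "L2_carrier M = {f \<in> borel_measurable M. integrable M (\<lambda>\<omega>. (cmod (f \<omega>))\<^sup>2)}"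

definition L2_dist :: "'a measure \<Rightarrow> ('a \<Rightarrow> complex) \<Rightarrow> ('a \<Rightarrow> complex) \<Rightarrow> real" where
  "L2_dist M f g = sqrt (\<integral>\<omega>. (cmod (f \<omega> - g \<omega>))\<^sup>2 \<partial>M)"

definition complex_span :: "('a \<Rightarrow> complex) set \<Rightarrow> ('a \<Rightarrow> complex) set" where
  "complex_span S = {(\<lambda>\<omega>. \<Sum>f\<in>F. c f * f \<omega>) | F c. finite F \<and> F \<subseteq> S}"

definition L2_closure :: "'a measure \<Rightarrow> ('a \<Rightarrow> complex) set \<Rightarrow> ('a \<Rightarrow> complex) set" where
  "L2_closure M S = {f \<in> L2_carrier M. \<forall>\<epsilon>>0. \<exists>g\<in>S. L2_dist M f g < \<epsilon>}"

definition L2_infdist :: "'a measure \<Rightarrow> ('a \<Rightarrow> complex) \<Rightarrow> ('a \<Rightarrow> complex) set \<Rightarrow> real" where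
  "L2_infdist M f S = (INF g\<in>S. L2_dist M f g)"

definition Cov :: "'a measure \<Rightarrow> ('a \<Rightarrow> complex) \<Rightarrow> ('a \<Rightarrow> complex) \<Rightarrow> complex" where
  "Cov M X Y = (\<integral>\<omega>. X \<omega> * cnj (Y \<omega>) \<partial>M)"

definition mean_zero_L2 :: "'a measure \<Rightarrow> ('a \<Rightarrow> complex) \<Rightarrow> bool" where
  "mean_zero_L2 M X \<longleftrightarrow> X \<in> L2_carrier M \<and> (\<integral>\<omega>. X \<omega> \<partial>M) = 0"

section \<open>Stationary processes on the natural numbers\<close>

definition stationary_process :: "'a measure \<Rightarrow> (nat \<Rightarrow> 'a \<Rightarrow> complex) \<Rightarrow> bool" where
  "stationary_process M Y \<longleftrightarrow>
     (\<forall>n. mean_zero_L2 M (Y n)) \<and>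
     (\<forall>n m k. Cov M (Y n) (Y (n + k)) = Cov M (Y m) (Y (m + k)))"

definition spectral_measure ::
    "'a measure \<Rightarrow> (nat \<Rightarrow> 'a \<Rightarrow> complex) \<Rightarrow> real measure \<Rightarrow> bool" where
  "spectral_measure M Y \<nu> \<longleftrightarrow>
     torus_measure \<nu> \<and> (\<forall>n k. Cov M (Y n) (Y (n + k)) = fourier_coeff \<nu> (int k))"

section \<open>Branching-type stationary processes\<close>

text \<open>
  The free semigroup on \<open>q\<close> generators is the set of words over the letters \<open>0, \<dots>, q - 1\<close>: the
  product is concatenation and the neutral element is the empty word.
\<close>

definition words :: "nat \<Rightarrow> nat list set" where
  "words q = lists {..<q}"

definition comparable :: "nat list \<Rightarrow> nat list \<Rightarrow> bool" where
  "comparable \<sigma> \<delta> \<longleftrightarrow> prefix \<sigma> \<delta> \<or> prefix \<delta> \<sigma>"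

definition rooted_ray :: "nat \<Rightarrow> (nat \<Rightarrow> nat list) \<Rightarrow> bool" where
  "rooted_ray q \<xi> \<longleftrightarrow> \<xi> 0 = [] \<and> (\<forall>n. \<exists>s<q. \<xi> (Suc n) = \<xi> n @ [s])"

definition common_spectral_measure ::
    "nat \<Rightarrow> 'a measure \<Rightarrow> (nat list \<Rightarrow> 'a \<Rightarrow> complex) \<Rightarrow> real measure \<Rightarrow> bool" where
  "common_spectral_measure q M X \<mu> \<longleftrightarrow>
     (\<forall>\<xi>. rooted_ray q \<xi> \<longrightarrow> spectral_measure M (\<lambda>n. X (\<xi> n)) \<mu>)"

definition branching_stationary ::
    "nat \<Rightarrow> 'a measure \<Rightarrow> (nat list \<Rightarrow> 'a \<Rightarrow> complex) \<Rightarrow> bool" where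
  "branching_stationary q M X \<longleftrightarrow>
     (\<forall>\<sigma>\<in>words q. mean_zero_L2 M (X \<sigma>)) \<and>
     (\<forall>\<xi>. rooted_ray q \<xi> \<longrightarrow> stationary_process M (\<lambda>n. X (\<xi> n))) \<and>
     (\<exists>\<mu>. common_spectral_measure q M X \<mu>) \<and>
     (\<forall>\<sigma>\<in>words q. \<forall>\<tau>\<in>words q. \<not> comparable \<sigma> \<tau> \<longrightarrow> Cov M (X \<sigma>) (X \<tau>) = 0)"

lemma ex_rooted_ray_through:
  assumes "\<sigma> \<in> words q" "0 < q"
  obtains \<xi> where "rooted_ray q \<xi>" "\<And>n. n \<le> length \<sigma> \<Longrightarrow> \<xi> n = take n \<sigma>"
proof
  let ?\<xi> = "\<lambda>n. take n \<sigma> @ replicate (n - length \<sigma>) 0"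
  have "\<exists>s<q. ?\<xi> (Suc n) = ?\<xi> n @ [s]" for n
  proof (cases "n < length \<sigma>")
    case True
    then have "\<sigma> ! n < q" using assms(1) by (auto simp: words_def in_lists_conv_set)
    then show ?thesis using True by (auto simp: take_Suc_conv_app_nth)
  next
    case False
    then have "?\<xi> (Suc n) = ?\<xi> n @ [0]"
      by (simp add: Suc_diff_le replicate_append_same)
    then show ?thesis using assms(2) by blast
  qed
  then show "rooted_ray q ?\<xi>" by (simp add: rooted_ray_def)
qed simp

lemma Cov_commute: "Cov M Y X = cnj (Cov M X Y)"
proof -
  have "(\<lambda>\<omega>. Y \<omega> * cnj (X \<omega>)) = (\<lambda>\<omega>. cnj (X \<omega> * cnj (Y \<omega>)))"
    by (simp add: mult.commute)
  then show ?thesis unfolding Cov_def by (simp only: Bochner_Integration.integral_cnj)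
qed

lemma branching_stationary_Cov:
  assumes "0 < q" "branching_stationary q M X" "common_spectral_measure q M X \<mu>"
    and "\<sigma> \<in> words q" "w \<in> words q"
  shows "Cov M (X \<sigma>) (X (\<sigma> @ w)) = fourier_coeff \<mu> (int (length w))"
    and "Cov M (X (\<sigma> @ w)) (X \<sigma>) = cnj (fourier_coeff \<mu> (int (length w)))"
proof -
  have "\<sigma> @ w \<in> words q" using assms(4,5) by (simp add: words_def)
  then obtain \<xi> where \<xi>: "rooted_ray q \<xi>"
      "\<And>n. n \<le> length (\<sigma> @ w) \<Longrightarrow> \<xi> n = take n (\<sigma> @ w)"
    using ex_rooted_ray_through[OF _ assms(1)] by blast
  have "Cov M (X (\<xi> (length \<sigma>))) (X (\<xi> (length \<sigma> + length w)))
      = fourier_coeff \<mu> (int (length w))"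
    using assms(3) \<xi>(1) by (auto simp: common_spectral_measure_def spectral_measure_def)
  then show *: "Cov M (X \<sigma>) (X (\<sigma> @ w)) = fourier_coeff \<mu> (int (length w))"
    using \<xi>(2)[of "length \<sigma>"] \<xi>(2)[of "length \<sigma> + length w"] by simp
  show "Cov M (X (\<sigma> @ w)) (X \<sigma>) = cnj (fourier_coeff \<mu> (int (length w)))"
    by (subst Cov_commute) (simp add: *)
qed

end

theory Submission
  imports Defs "HOL-Computational_Algebra.Fundamental_Theorem_Algebra"
begin

text \<open>
  The covariances depend only on relative position in the tree, so the best prediction of the root
  may be sought among combinations that are constant on levels. Indeed, the normalised level sums
  \<open>radial n\<close> span a subspace onto which one projects by averaging coefficients over levels, because the
  covariance of \<open>X \<sigma>\<close> with any level sum depends only on the length of \<open>\<sigma>\<close> (\<open>radial_projection\<close>). A word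
  has \<open>q ^ k\<close> descendants \<open>k\<close> levels below, and after normalisation half of this exponent survives: the
  level sums form a stationary sequence with spectral measure \<open>\<nu>\<alpha>\<close>. The spectral isometry therefore
  identifies the squared distance with the infimum of \<open>\<integral> \<bar>p\<bar>\<^sup>2 d\<nu>\<alpha>\<close> over polynomials \<open>p\<close> with \<open>p(0) = 1\<close>
  (\<open>L2_infdist_eq_sqrt_szego_infimum\<close>), and the claim becomes the theorem of Szego, Kolmogorov and
  Krein, that this infimum is the geometric mean \<open>exp (\<integral> log w dm)\<close> of the absolutely continuous part.

  For the upper bound, \<open>exp f\<close> is an admissible competitor for every polynomial \<open>f\<close> with \<open>f(0) = 0\<close>,
  being a bounded pointwise limit of admissible polynomials, and \<open>\<bar>exp f\<bar>\<^sup>2 = exp (2 Re f)\<close>. Real parts of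
  polynomials are uniformly dense in the continuous functions, and these are dense in \<open>L\<^sup>1\<close>; hence the
  infimum is at most \<open>exp (- \<integral> u dm) \<integral> exp u d\<nu>\<close> for every bounded Borel function \<open>u\<close>
  (\<open>szego_infimum_le_exp_bounded\<close>). Now \<open>u\<close> can be taken close to \<open>- log w\<close> off the null set that
  carries the singular part, and very negative on that set, so that the singular part does not
  contribute in the limit (\<open>szego_infimum_upper_bound\<close>).

  For the lower bound, reflecting the roots of \<open>p\<close> out of the disc only decreases \<open>\<bar>p\<bar>\<close> on the circle
  (\<open>poly_ge_prod_reflected_roots\<close>). After a small perturbation that moves the roots off the circle,
  \<open>log \<bar>p\<bar>\<close> has mean \<open>log \<bar>p(0)\<bar> = 0\<close>, and Jensen's inequality yields
  \<open>\<integral> \<bar>p\<bar>\<^sup>2 w dm \<ge> exp (\<integral> log w dm)\<close> (\<open>szego_infimum_lower_bound\<close>).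
\<close>

section \<open>The geometry of square-integrable variables\<close>

lemma L2_carrierD:
  "f \<in> L2_carrier M \<Longrightarrow> f \<in> borel_measurable M"
  "f \<in> L2_carrier M \<Longrightarrow> integrable M (\<lambda>\<omega>. (cmod (f \<omega>))\<^sup>2)"
  by (auto simp: L2_carrier_def)

lemma integrable_L2_mult_cnj:
  assumes "f \<in> L2_carrier M" "g \<in> L2_carrier M"
  shows "integrable M (\<lambda>\<omega>. f \<omega> * cnj (g \<omega>))"
proof (rule Bochner_Integration.integrable_bound)
  show "integrable M (\<lambda>\<omega>. (cmod (f \<omega>))\<^sup>2 + (cmod (g \<omega>))\<^sup>2)"
    using assms L2_carrierD by (intro Bochner_Integration.integrable_add) auto
  have "g \<in> borel_measurable M" "f \<in> borel_measurable M" using assms L2_carrierD by auto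
  then show "(\<lambda>\<omega>. f \<omega> * cnj (g \<omega>)) \<in> borel_measurable M"
    by (intro borel_measurable_times borel_measurable_continuous_on[of cnj] continuous_intros)
  have "a * b \<le> a\<^sup>2 + b\<^sup>2" if "0 \<le> a" "0 \<le> b" for a b :: real
    using sum_squares_bound[of a b] that mult_nonneg_nonneg[OF that] by linarith
  then show "AE \<omega> in M. norm (f \<omega> * cnj (g \<omega>)) \<le> norm ((cmod (f \<omega>))\<^sup>2 + (cmod (g \<omega>))\<^sup>2)"
    by (simp add: norm_mult)
qed

lemma L2_carrier_add:
  assumes "f \<in> L2_carrier M" "g \<in> L2_carrier M"
  shows "(\<lambda>\<omega>. f \<omega> + g \<omega>) \<in> L2_carrier M"
proof -
  have m: "f \<in> borel_measurable M" "g \<in> borel_measurable M" using assms L2_carrierD by auto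
  have "integrable M (\<lambda>\<omega>. (cmod (f \<omega> + g \<omega>))\<^sup>2)"
  proof (rule Bochner_Integration.integrable_bound)
    show "integrable M (\<lambda>\<omega>. 2 * (cmod (f \<omega>))\<^sup>2 + 2 * (cmod (g \<omega>))\<^sup>2)"
      using assms L2_carrierD by (intro Bochner_Integration.integrable_add integrable_mult_right) auto
    have "(cmod (x + y))\<^sup>2 \<le> 2 * (cmod x)\<^sup>2 + 2 * (cmod y)\<^sup>2" for x y
    proof -
      have "(cmod (x + y))\<^sup>2 \<le> (cmod x + cmod y)\<^sup>2" by (intro power_mono norm_triangle_ineq) auto
      also have "\<dots> \<le> 2 * (cmod x)\<^sup>2 + 2 * (cmod y)\<^sup>2"
        using sum_squares_bound[of "cmod x" "cmod y"] by (simp add: power2_sum)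
      finally show ?thesis .
    qed
    then show "AE \<omega> in M. norm ((cmod (f \<omega> + g \<omega>))\<^sup>2) \<le> norm (2 * (cmod (f \<omega>))\<^sup>2 + 2 * (cmod (g \<omega>))\<^sup>2)"
      by simp
  qed (use m in measurable)
  then show ?thesis using m by (simp add: L2_carrier_def)
qed

lemma L2_carrier_scale: "f \<in> L2_carrier M \<Longrightarrow> (\<lambda>\<omega>. c * f \<omega>) \<in> L2_carrier M"
  by (auto simp: L2_carrier_def norm_mult power_mult_distrib)

lemma L2_carrier_zero: "(\<lambda>\<omega>. 0) \<in> L2_carrier M"
  by (simp add: L2_carrier_def)

lemma L2_carrier_diff:
  "f \<in> L2_carrier M \<Longrightarrow> g \<in> L2_carrier M \<Longrightarrow> (\<lambda>\<omega>. f \<omega> - g \<omega>) \<in> L2_carrier M"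
  using L2_carrier_add[OF _ L2_carrier_scale[of g M "-1"]] by simp

lemma L2_carrier_lincomb:
  "(\<And>a. a \<in> A \<Longrightarrow> F a \<in> L2_carrier M) \<Longrightarrow> (\<lambda>\<omega>. \<Sum>a\<in>A. c a * F a \<omega>) \<in> L2_carrier M"
  by (induction A rule: infinite_finite_induct)
     (auto intro!: L2_carrier_add L2_carrier_scale L2_carrier_zero)

lemma Cov_lincomb_left:
  assumes "\<And>a. a \<in> A \<Longrightarrow> F a \<in> L2_carrier M" "G \<in> L2_carrier M"
  shows "Cov M (\<lambda>\<omega>. \<Sum>a\<in>A. c a * F a \<omega>) G = (\<Sum>a\<in>A. c a * Cov M (F a) G)"
proof -
  have "Cov M (\<lambda>\<omega>. \<Sum>a\<in>A. c a * F a \<omega>) G = (\<integral>\<omega>. (\<Sum>a\<in>A. c a * (F a \<omega> * cnj (G \<omega>))) \<partial>M)"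
    by (simp add: Cov_def sum_distrib_right mult.assoc)
  also have "\<dots> = (\<Sum>a\<in>A. \<integral>\<omega>. c a * (F a \<omega> * cnj (G \<omega>)) \<partial>M)"
    using assms by (intro Bochner_Integration.integral_sum integrable_mult_right integrable_L2_mult_cnj) auto
  finally show ?thesis by (simp add: Cov_def)
qed

lemma Cov_lincomb_right:
  assumes "\<And>a. a \<in> A \<Longrightarrow> F a \<in> L2_carrier M" "G \<in> L2_carrier M"
  shows "Cov M G (\<lambda>\<omega>. \<Sum>a\<in>A. c a * F a \<omega>) = (\<Sum>a\<in>A. cnj (c a) * Cov M G (F a))"
  by (subst Cov_commute, subst Cov_lincomb_left[OF assms])
     (auto simp: Cov_commute[of M _ G])

lemma Cov_self: "Cov M f f = of_real (\<integral>\<omega>. (cmod (f \<omega>))\<^sup>2 \<partial>M)"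
  by (simp add: Cov_def complex_norm_square[symmetric] del: of_real_power)

text \<open>The hypothesis says that \<open>R\<close> is orthogonal to \<open>Z - R\<close>, so this is Pythagoras; the pointwise
  bound \<open>2 Re (Z cnj R) \<le> \<bar>Z\<bar>\<^sup>2 + \<bar>R\<bar>\<^sup>2\<close> gives it without expanding \<open>Z - R\<close>.\<close>

lemma L2_norm_projection_le:
  assumes "Z \<in> L2_carrier M" "R \<in> L2_carrier M" and orth: "Cov M Z R = Cov M R R"
  shows "(\<integral>\<omega>. (cmod (R \<omega>))\<^sup>2 \<partial>M) \<le> (\<integral>\<omega>. (cmod (Z \<omega>))\<^sup>2 \<partial>M)"
proof -
  have *: "2 * Re (z * cnj r) \<le> (cmod z)\<^sup>2 + (cmod r)\<^sup>2" for z r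
  proof -
    have "Re (z * cnj r) \<le> cmod z * cmod r" using complex_Re_le_cmod[of "z * cnj r"] by (simp add: norm_mult)
    then show ?thesis using sum_squares_bound[of "cmod z" "cmod r"] by linarith
  qed
  have "2 * (\<integral>\<omega>. (cmod (R \<omega>))\<^sup>2 \<partial>M) = 2 * Re (Cov M Z R)" by (simp add: orth Cov_self)
  also have "\<dots> = (\<integral>\<omega>. 2 * Re (Z \<omega> * cnj (R \<omega>)) \<partial>M)"
    by (simp only: Cov_def integral_mult_right_zero integral_Re[OF integrable_L2_mult_cnj[OF assms(1,2)]])
  also have "\<dots> \<le> (\<integral>\<omega>. (cmod (Z \<omega>))\<^sup>2 + (cmod (R \<omega>))\<^sup>2 \<partial>M)"
    using integrable_L2_mult_cnj[OF assms(1,2)] L2_carrierD(2) assms(1,2) *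
    by (intro integral_mono integrable_mult_right Bochner_Integration.integrable_add integrable_Re) auto
  also have "\<dots> = (\<integral>\<omega>. (cmod (Z \<omega>))\<^sup>2 \<partial>M) + (\<integral>\<omega>. (cmod (R \<omega>))\<^sup>2 \<partial>M)"
    using L2_carrierD(2) assms(1,2) by (intro Bochner_Integration.integral_add) auto
  finally show ?thesis by simp
qed

lemma L2_dist_power2: "(L2_dist M f g)\<^sup>2 = (\<integral>\<omega>. (cmod (f \<omega> - g \<omega>))\<^sup>2 \<partial>M)"
  by (simp add: L2_dist_def)

lemma L2_dist_nonneg: "0 \<le> L2_dist M f g"
  by (simp add: L2_dist_def)

text \<open>For positive \<open>a\<close> and \<open>b\<close> the weighted inequality
  \<open>\<bar>x + y\<bar>\<^sup>2 \<le> (1 + b / a) \<bar>x\<bar>\<^sup>2 + (1 + a / b) \<bar>y\<bar>\<^sup>2\<close> integrates to the bound \<open>(a + b)\<^sup>2\<close> as soon as the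
  two distances are at most \<open>a\<close> and \<open>b\<close>. Enlarging both distances by \<open>e / 2\<close> makes the weights
  well defined when a distance is zero.\<close>

lemma L2_dist_triangle:
  assumes "f \<in> L2_carrier M" "g \<in> L2_carrier M" "h \<in> L2_carrier M"
  shows "L2_dist M f h \<le> L2_dist M f g + L2_dist M g h"
proof (rule field_le_epsilon)
  fix e :: real assume e: "0 < e"
  define a b where "a = L2_dist M f g + e / 2" and "b = L2_dist M g h + e / 2"
  have ab: "0 < a" "0 < b" using L2_dist_nonneg[of M f g] L2_dist_nonneg[of M g h] e
    by (auto simp: a_def b_def)
  have le: "(\<integral>\<omega>. (cmod (f \<omega> - g \<omega>))\<^sup>2 \<partial>M) \<le> a\<^sup>2" "(\<integral>\<omega>. (cmod (g \<omega> - h \<omega>))\<^sup>2 \<partial>M) \<le> b\<^sup>2"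
    using L2_dist_nonneg e by (auto simp: a_def b_def L2_dist_power2[symmetric] intro!: power_mono)
  have *: "(cmod (x + y))\<^sup>2 \<le> (1 + b / a) * (cmod x)\<^sup>2 + (1 + a / b) * (cmod y)\<^sup>2" for x y
  proof -
    have "0 \<le> (b * cmod x - a * cmod y)\<^sup>2 / (a * b)" using ab by simp
    then have "2 * cmod x * cmod y \<le> b / a * (cmod x)\<^sup>2 + a / b * (cmod y)\<^sup>2"
      using ab by (simp add: power2_diff power2_eq_square field_simps)
    moreover have "(cmod (x + y))\<^sup>2 \<le> (cmod x + cmod y)\<^sup>2" by (intro power_mono norm_triangle_ineq) auto
    ultimately show ?thesis by (simp add: power2_sum algebra_simps)
  qed
  have fg: "integrable M (\<lambda>\<omega>. (cmod (f \<omega> - g \<omega>))\<^sup>2)" "integrable M (\<lambda>\<omega>. (cmod (g \<omega> - h \<omega>))\<^sup>2)"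
    "integrable M (\<lambda>\<omega>. (cmod (f \<omega> - h \<omega>))\<^sup>2)"
    using assms by (auto intro: L2_carrierD(2) L2_carrier_diff)
  have "(L2_dist M f h)\<^sup>2
      \<le> (\<integral>\<omega>. (1 + b / a) * (cmod (f \<omega> - g \<omega>))\<^sup>2 + (1 + a / b) * (cmod (g \<omega> - h \<omega>))\<^sup>2 \<partial>M)"
    unfolding L2_dist_power2
  proof (rule integral_mono)
    show "(cmod (f \<omega> - h \<omega>))\<^sup>2
      \<le> (1 + b / a) * (cmod (f \<omega> - g \<omega>))\<^sup>2 + (1 + a / b) * (cmod (g \<omega> - h \<omega>))\<^sup>2" for \<omega>
      using *[of "f \<omega> - g \<omega>" "g \<omega> - h \<omega>"] by simp
  qed (use fg in auto)
  also have "\<dots> = (1 + b / a) * (\<integral>\<omega>. (cmod (f \<omega> - g \<omega>))\<^sup>2 \<partial>M) + (1 + a / b) * (\<integral>\<omega>. (cmod (g \<omega> - h \<omega>))\<^sup>2 \<partial>M)"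
    using fg by (subst Bochner_Integration.integral_add) auto
  also have "\<dots> \<le> (1 + b / a) * a\<^sup>2 + (1 + a / b) * b\<^sup>2"
    using le ab by (intro add_mono mult_left_mono) auto
  also have "\<dots> = (a + b)\<^sup>2" using ab by (simp add: power2_eq_square field_simps)
  finally have "L2_dist M f h \<le> a + b" using ab by (auto dest: power2_le_imp_le)
  then show "L2_dist M f h \<le> L2_dist M f g + L2_dist M g h + e" by (simp add: a_def b_def)
qed

lemma L2_infdist_closure:
  assumes f: "f \<in> L2_carrier M" and S: "S \<subseteq> L2_carrier M" "S \<noteq> {}"
  shows "L2_infdist M f (L2_closure M S) = L2_infdist M f S"
proof (rule antisym)
  have bdd: "bdd_below (L2_dist M f ` A)" for A
    using L2_dist_nonneg by (intro bdd_belowI2) auto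
  have sub: "S \<subseteq> L2_closure M S"
  proof
    fix g assume "g \<in> S"
    moreover have "L2_dist M g g = 0" by (simp add: L2_dist_def)
    ultimately show "g \<in> L2_closure M S" using S(1) by (auto simp: L2_closure_def intro!: bexI[of _ g])
  qed
  show "L2_infdist M f (L2_closure M S) \<le> L2_infdist M f S"
    unfolding L2_infdist_def by (rule cINF_superset_mono[OF S(2) bdd sub]) simp
  show "L2_infdist M f S \<le> L2_infdist M f (L2_closure M S)"
    unfolding L2_infdist_def[of _ _ "L2_closure M S"]
  proof (rule cINF_greatest)
    show "L2_closure M S \<noteq> {}" using sub S by auto
    fix h assume h: "h \<in> L2_closure M S"
    show "L2_infdist M f S \<le> L2_dist M f h"
    proof (rule field_le_epsilon)
      fix e :: real assume "0 < e"
      then obtain g where g: "g \<in> S" "L2_dist M h g < e" using h by (auto simp: L2_closure_def)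
      have "L2_infdist M f S \<le> L2_dist M f g"
        unfolding L2_infdist_def by (rule cINF_lower[OF bdd g(1)])
      also have "\<dots> \<le> L2_dist M f h + L2_dist M h g"
        using f h g S by (intro L2_dist_triangle) (auto simp: L2_closure_def)
      finally show "L2_infdist M f S \<le> L2_dist M f h + e" using g by simp
    qed
  qed
qed

text \<open>\<open>X\<close> need not be injective: coefficients of indices with the same value are added up in one direction,
  and representatives are chosen in the other.\<close>

lemma complex_span_image:
  "complex_span (X ` A) = {(\<lambda>\<omega>. \<Sum>\<sigma>\<in>B. c \<sigma> * X \<sigma> \<omega>) | B c. finite B \<and> B \<subseteq> A}"
proof (intro equalityI subsetI)
  fix g assume "g \<in> complex_span (X ` A)"
  then obtain F c where F: "finite F" "F \<subseteq> X ` A" "g = (\<lambda>\<omega>. \<Sum>f\<in>F. c f * f \<omega>)"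
    by (auto simp: complex_span_def)
  then obtain B where B: "B \<subseteq> A" "inj_on X B" "F = X ` B" by (auto simp: subset_image_inj)
  then have "finite B" using F finite_image_iff by blast
  moreover have "g = (\<lambda>\<omega>. \<Sum>\<sigma>\<in>B. c (X \<sigma>) * X \<sigma> \<omega>)"
    unfolding F(3) B(3) by (simp add: sum.reindex[OF B(2)])
  ultimately show "g \<in> {(\<lambda>\<omega>. \<Sum>\<sigma>\<in>B. c \<sigma> * X \<sigma> \<omega>) | B c. finite B \<and> B \<subseteq> A}"
    using B(1) by (intro CollectI exI[of _ B] exI[of _ "\<lambda>\<sigma>. c (X \<sigma>)"]) auto
next
  fix g assume "g \<in> {(\<lambda>\<omega>. \<Sum>\<sigma>\<in>B. c \<sigma> * X \<sigma> \<omega>) | B c. finite B \<and> B \<subseteq> A}"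
  then obtain B c where B: "finite B" "B \<subseteq> A" "g = (\<lambda>\<omega>. \<Sum>\<sigma>\<in>B. c \<sigma> * X \<sigma> \<omega>)" by blast
  have "g = (\<lambda>\<omega>. \<Sum>f\<in>X ` B. (\<Sum>\<sigma>\<in>{\<sigma>\<in>B. X \<sigma> = f}. c \<sigma>) * f \<omega>)"
  proof
    fix \<omega>
    have "g \<omega> = (\<Sum>f\<in>X ` B. \<Sum>\<sigma>\<in>{\<sigma>\<in>B. X \<sigma> = f}. c \<sigma> * X \<sigma> \<omega>)"
      unfolding B(3) by (rule sum.image_gen[OF B(1)])
    then show "g \<omega> = (\<Sum>f\<in>X ` B. (\<Sum>\<sigma>\<in>{\<sigma>\<in>B. X \<sigma> = f}. c \<sigma>) * f \<omega>)"
      by (simp add: sum_distrib_right)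
  qed
  then show "g \<in> complex_span (X ` A)"
    using B(1,2) unfolding complex_span_def
    by (intro CollectI exI[of _ "X ` B"] exI[of _ "\<lambda>f. \<Sum>\<sigma>\<in>{\<sigma>\<in>B. X \<sigma> = f}. c \<sigma>"]) auto
qed

section \<open>Measures on the torus\<close>

lemma nn_integral_add_measure:
  assumes sets: "sets A = sets N" "sets B = sets N"
    and add: "\<And>S. S \<in> sets N \<Longrightarrow> emeasure N S = emeasure A S + emeasure B S"
    and f: "f \<in> borel_measurable N"
  shows "(\<integral>\<^sup>+x. f x \<partial>N) = (\<integral>\<^sup>+x. f x \<partial>A) + (\<integral>\<^sup>+x. f x \<partial>B)"
proof -
  have [simp]: "g \<in> borel_measurable A" "g \<in> borel_measurable B"
    if "g \<in> borel_measurable N" for g :: "'a \<Rightarrow> ennreal"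
    using that by (simp_all add: measurable_cong_sets[OF sets(1) refl] measurable_cong_sets[OF sets(2) refl])
  show ?thesis
    using f
  proof (induction rule: borel_measurable_induct)
    case (cong f g)
    then show ?case
      using sets_eq_imp_space_eq[OF sets(1)] sets_eq_imp_space_eq[OF sets(2)]
      by (metis nn_integral_cong)
  next
    case (set S)
    then show ?case using add sets by simp
  next
    case (mult u c)
    then show ?case by (simp add: nn_integral_cmult distrib_left)
  next
    case (add u v)
    then show ?case by (simp add: nn_integral_add ac_simps)
  next
    case (seq U)
    have mono: "incseq (\<lambda>i. \<integral>\<^sup>+x. U i x \<partial>K)" for K :: "'a measure"
      using \<open>incseq U\<close> by (auto simp: incseq_def le_fun_def intro!: nn_integral_mono)
    show ?case
      using seq mono
      by (simp add: nn_integral_monotone_convergence_SUP image_comp ennreal_SUP_add SUP_apply[abs_def])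
  qed
qed

lemma ex_add_measure:
  assumes sets: "sets A = sets B" and fin: "finite_measure A" "finite_measure B"
  obtains N where "sets N = sets B" "finite_measure N"
    "\<And>S. S \<in> sets N \<Longrightarrow> emeasure N S = emeasure A S + emeasure B S"
proof -
  define N where "N = measure_of (space B) (sets B) (\<lambda>S. emeasure A S + emeasure B S)"
  have setsN: "sets N = sets B" by (simp add: N_def)
  have em: "emeasure N S = emeasure A S + emeasure B S" if "S \<in> sets N" for S
    using N_def
  proof (rule emeasure_measure_of)
    show "sets B \<subseteq> Pow (space B)" by (rule sets.space_closed)
    show "S \<in> sets N" by fact
    show "positive (sets N) (\<lambda>S. emeasure A S + emeasure B S)" by (simp add: positive_def)
    show "countably_additive (sets N) (\<lambda>S. emeasure A S + emeasure B S)"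
      unfolding countably_additive_def
    proof (intro allI impI)
      fix F :: "nat \<Rightarrow> 'a set" assume F: "range F \<subseteq> sets N" "disjoint_family F"
      then show "(\<Sum>i. emeasure A (F i) + emeasure B (F i))
          = emeasure A (\<Union>(range F)) + emeasure B (\<Union>(range F))"
        using sets setsN by (simp add: suminf_add[symmetric] suminf_emeasure)
    qed
  qed
  moreover have "finite_measure N"
    using fin em[of "space N"] sets_eq_imp_space_eq[OF sets] sets_eq_imp_space_eq[OF setsN]
    by (intro finite_measureI)
       (metis ennreal_add_eq_top finite_measure.emeasure_finite infinity_ennreal_def sets.top)
  ultimately show ?thesis using setsN that by blast
qed

lemma space_torus_measure: "torus_measure \<nu> \<Longrightarrow> space \<nu> = {0..<2 * pi}"
  unfolding torus_measure_def by (metis sets_eq_imp_space_eq space_restrict_space2 sets.space_closed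
    Int_UNIV_right space_borel space_restrict_space)

lemma measurable_torus_measure:
  assumes "torus_measure \<nu>" "f \<in> borel_measurable borel"
  shows "f \<in> borel_measurable \<nu>"
  using assms measurable_restrict_space1[of f borel borel "{0..<2 * pi}"]
  unfolding torus_measure_def by (metis measurable_cong_sets)

lemma measurable_cis_torus_measure [measurable]:
  "torus_measure \<nu> \<Longrightarrow> cis \<in> borel_measurable \<nu>"
  by (rule measurable_torus_measure) (auto intro!: borel_measurable_continuous_onI continuous_intros)

lemma integrable_torus_continuous:
  fixes g :: "complex \<Rightarrow> 'b :: {banach, second_countable_topology}"
  assumes "torus_measure \<nu>" "continuous_on UNIV g"
  shows "integrable \<nu> (\<lambda>\<theta>. g (cis \<theta>))"
proof -
  interpret finite_measure \<nu> using assms(1) by (simp add: torus_measure_def)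
  have "compact (g ` sphere 0 1)"
    using assms(2) by (intro compact_continuous_image) (auto intro: continuous_on_subset)
  then obtain B where "\<And>y. y \<in> g ` sphere 0 1 \<Longrightarrow> norm y \<le> B"
    using compact_imp_bounded bounded_iff by metis
  then have "\<And>\<theta>. norm (g (cis \<theta>)) \<le> B" by simp
  moreover have "(\<lambda>\<theta>. g (cis \<theta>)) \<in> borel_measurable \<nu>"
    by (rule measurable_compose[OF measurable_cis_torus_measure[OF assms(1)]])
       (rule borel_measurable_continuous_onI[OF assms(2)])
  ultimately show ?thesis by (intro integrable_const_bound) auto
qed

lemma torus_measure_haar: "torus_measure torus_haar"
  and prob_space_haar: "prob_space torus_haar"
proof -
  have [simp]: "emeasure lborel {0..<2*pi} = ennreal (2*pi)" by simp
  have s: "sets torus_haar = sets (restrict_space borel {0..<2*pi})"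
    unfolding torus_haar_def by (rule sets_restrict_space_cong) simp
  have "emeasure (uniform_measure lborel {0..<2*pi}) {0..<2*pi} = 1"
    by (subst emeasure_uniform_measure) (auto intro!: ennreal_divide_self)
  then show "prob_space torus_haar"
    unfolding torus_haar_def by (intro prob_spaceI) (simp add: emeasure_restrict_space space_restrict_space)
  then show "torus_measure torus_haar"
    using s by (simp add: torus_measure_def prob_space.finite_measure)
qed

lemma measurable_cis: "(\<lambda>x. cis (c * x)) \<in> borel_measurable borel"
  by (intro borel_measurable_continuous_onI continuous_intros)

lemma integral_haar_cis_power:
  assumes "n \<noteq> 0"
  shows "(\<integral>\<theta>. cis \<theta> ^ n \<partial>torus_haar) = 0"
proof -
  have "(\<integral>\<theta>. cis \<theta> ^ n \<partial>torus_haar)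
      = (\<integral>\<theta>. indicator {0..<2*pi} \<theta> *\<^sub>R cis \<theta> ^ n \<partial>uniform_measure lborel {0..<2*pi})"
    unfolding torus_haar_def by (subst integral_restrict_space) auto
  also have "\<dots> = (\<integral>\<theta>. (indicator {0..<2*pi} \<theta> / (2*pi)) *\<^sub>R (indicator {0..<2*pi} \<theta> *\<^sub>R cis \<theta> ^ n) \<partial>lborel)"
  proof -
    have "uniform_measure lborel {0..<2*pi} = density lborel (\<lambda>\<theta>. ennreal (indicator {0..<2*pi} \<theta> / (2*pi)))"
      unfolding uniform_measure_def
      by (intro density_cong) (auto simp: indicator_def divide_ennreal ennreal_1[symmetric] simp del: ennreal_1)
    moreover have "(\<lambda>\<theta>. cis \<theta> ^ n) \<in> borel_measurable borel"
      by (intro borel_measurable_continuous_onI continuous_intros)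
    ultimately show ?thesis by (simp only:) (intro integral_density, auto)
  qed
  also have "\<dots> = (\<integral>\<theta>. (1/(2*pi)) *\<^sub>R (indicator {0..2*pi} \<theta> *\<^sub>R cis (real n * \<theta>)) \<partial>lborel)"
  proof (rule integral_cong_AE)
    show "AE \<theta> in lborel. (indicator {0..<2*pi} \<theta> / (2*pi)) *\<^sub>R (indicator {0..<2*pi} \<theta> *\<^sub>R cis \<theta> ^ n) =
        (1/(2*pi)) *\<^sub>R (indicator {0..2*pi} \<theta> *\<^sub>R cis (real n * \<theta>))"
      using AE_lborel_singleton[of "2*pi"] by eventually_elim (auto simp: indicator_def Complex.DeMoivre simp del: cis_mult)
  qed (auto intro!: borel_measurable_scaleR borel_measurable_power measurable_cis measurable_cis[of 1, simplified] intro: borel_measurable_continuous_onI continuous_intros)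
  also have "\<dots> = (1/(2*pi)) *\<^sub>R (\<integral>\<theta>. indicator {0..2*pi} \<theta> *\<^sub>R cis (real n * \<theta>) \<partial>lborel)"
    by (rule integral_scaleR_right)
  also have "(\<integral>\<theta>. indicator {0..2*pi} \<theta> *\<^sub>R cis (real n * \<theta>) \<partial>lborel)
      = cis (real n * (2*pi)) / (\<i> * n) - cis (real n * 0) / (\<i> * n)"
  proof (rule integral_FTC_atLeastAtMost)
    show "0 \<le> 2*pi" by simp
    show "((\<lambda>x. cis (real n * x) / (\<i> * n)) has_vector_derivative cis (real n * x)) (at x within {0..2*pi})" for x
    proof -
      have "((\<lambda>z. exp (\<i> * (of_nat n * z)) / (\<i> * n)) has_field_derivative exp (\<i> * (of_nat n * of_real x)))
          (at (of_real x))"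
        using assms by (auto intro!: derivative_eq_intros simp: mult.commute[of _ \<i>])
      from has_vector_derivative_real_field[OF this] show ?thesis by (simp add: cis_conv_exp)
    qed
  qed (intro continuous_intros)
  also have "cis (real n * (2*pi)) = 1"
    by (metis cis_multiple_2pi Ints_of_nat mult.commute of_int_of_nat_eq)
  finally show ?thesis by simp
qed

text \<open>The mean value property, which singles out the constant coefficient because nonconstant characters
  have mean zero.\<close>

lemma integral_haar_poly: "(\<integral>\<theta>. poly p (cis \<theta>) \<partial>torus_haar) = poly p 0"
proof (induction p)
  case 0
  then show ?case by simp
next
  case (pCons a p)
  interpret prob_space torus_haar by (rule prob_space_haar)
  have int: "integrable torus_haar (\<lambda>\<theta>. g (cis \<theta>))" if "continuous_on UNIV g" for g :: "complex \<Rightarrow> complex"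
    using integrable_torus_continuous[OF torus_measure_haar that] .
  have *: "(\<integral>\<theta>. cis \<theta> ^ Suc k * poly p (cis \<theta>) \<partial>torus_haar) = 0" for k
  proof (induction p arbitrary: k)
    case 0
    then show ?case by simp
  next
    case (pCons a p)
    have "(\<integral>\<theta>. cis \<theta> ^ Suc k * poly (pCons a p) (cis \<theta>) \<partial>torus_haar)
       = (\<integral>\<theta>. a * cis \<theta> ^ Suc k + cis \<theta> ^ Suc (Suc k) * poly p (cis \<theta>) \<partial>torus_haar)"
      by (simp add: algebra_simps)
    also have "\<dots> = (\<integral>\<theta>. a * cis \<theta> ^ Suc k \<partial>torus_haar) + (\<integral>\<theta>. cis \<theta> ^ Suc (Suc k) * poly p (cis \<theta>) \<partial>torus_haar)"
      by (intro Bochner_Integration.integral_add int[of "\<lambda>z. a * z ^ Suc k"]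
          int[of "\<lambda>z. z ^ Suc (Suc k) * poly p z"] continuous_intros)
    also have "\<dots> = 0"
      using pCons(2)[of "Suc k"] integral_haar_cis_power[of "Suc k"] by simp
    finally show ?case .
  qed
  have "(\<integral>\<theta>. poly (pCons a p) (cis \<theta>) \<partial>torus_haar)
       = (\<integral>\<theta>. a \<partial>torus_haar) + (\<integral>\<theta>. cis \<theta> ^ Suc 0 * poly p (cis \<theta>) \<partial>torus_haar)"
    using int[of "\<lambda>z. z * poly p z"]
    by (simp add: continuous_intros Bochner_Integration.integral_add)
  then show ?case using *[of 0] by (simp add: prob_space)
qed

section \<open>Approximation by polynomials and continuous functions\<close>

text \<open>On the circle a negative power of \<open>z\<close> is a power of its conjugate, and conjugating a term does not change
  its real part; so negative frequencies can be folded onto positive ones.\<close>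

lemma Re_laurent_eq_Re_poly:
  "\<exists>q. \<forall>z. cmod z = 1 \<longrightarrow> Re (cnj z ^ N * poly p z) = Re (poly q z)"
proof (induction p arbitrary: N)
  case 0
  show ?case by (rule exI[of _ 0]) simp
next
  case (pCons a p)
  show ?case
  proof (cases N)
    case 0
    then show ?thesis by (intro exI[of _ "pCons a p"]) simp
  next
    case (Suc n)
    obtain q where q: "\<And>z. cmod z = 1 \<Longrightarrow> Re (cnj z ^ n * poly p z) = Re (poly q z)"
      using pCons.IH[of n] by blast
    have "Re (cnj z ^ N * poly (pCons a p) z) = Re (poly (monom (cnj a) N + q) z)"
      if "cmod z = 1" for z
    proof -
      have "cnj z * z = 1" using that by (metis complex_norm_square mult.commute of_real_1 power_one)
      then have "cnj z ^ N * poly (pCons a p) z = cnj (cnj a * z ^ N) + cnj z ^ n * poly p z"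
        using Suc by (simp add: algebra_simps)
      moreover have "Re (cnj (cnj a * z ^ N)) = Re (cnj a * z ^ N)" by (rule cnj.sel(1))
      ultimately show ?thesis
        using q[OF that] by (simp only: poly_add poly_monom plus_complex.sel)
    qed
    then show ?thesis by blast
  qed
qed

text \<open>Stone-Weierstrass on the circle. The approximating ring consists of the functions that become
  algebraic polynomials after multiplication by a power of \<open>z\<close>, that is, of the real trigonometric
  polynomials; in this form closure under products is evident.\<close>

lemma ex_poly_Re_approx:
  fixes u :: "complex \<Rightarrow> real"
  assumes "continuous_on (sphere 0 1) u" "0 < e"
  obtains p where "\<And>z. cmod z = 1 \<Longrightarrow> \<bar>u z - Re (poly p z)\<bar> < e"
proof -
  define P where "P = (\<lambda>f :: complex \<Rightarrow> real. continuous_on (sphere 0 1) f \<and>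
      (\<exists>N p. \<forall>z. cmod z = 1 \<longrightarrow> z ^ N * of_real (f z) = poly p z))"
  have "\<exists>g. P g \<and> (\<forall>z\<in>sphere 0 1. \<bar>u z - g z\<bar> < e)"
  proof (rule Stone_Weierstrass_HOL)
    show "P (\<lambda>x. c)" for c
      unfolding P_def by (intro conjI exI[of _ 0] exI[of _ "[:of_real c:]"]) auto
    show "P (\<lambda>x. f x + g x)" if fg: "P f \<and> P g" for f g
    proof -
      obtain N p where p: "\<And>z. cmod z = 1 \<Longrightarrow> z ^ N * of_real (f z) = poly p z"
        using fg unfolding P_def by blast
      obtain K q where q: "\<And>z. cmod z = 1 \<Longrightarrow> z ^ K * of_real (g z) = poly q z"
        using fg unfolding P_def by blast
      have "\<forall>z. cmod z = 1 \<longrightarrow> z ^ (N + K) * of_real (f z + g z)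
          = poly (monom 1 K * p + monom 1 N * q) z"
        by (simp add: poly_monom algebra_simps power_add flip: p q)
      then show ?thesis using fg unfolding P_def by (blast intro: continuous_on_add)
    qed
    show "P (\<lambda>x. f x * g x)" if fg: "P f \<and> P g" for f g
    proof -
      obtain N p where p: "\<And>z. cmod z = 1 \<Longrightarrow> z ^ N * of_real (f z) = poly p z"
        using fg unfolding P_def by blast
      obtain K q where q: "\<And>z. cmod z = 1 \<Longrightarrow> z ^ K * of_real (g z) = poly q z"
        using fg unfolding P_def by blast
      have "\<forall>z. cmod z = 1 \<longrightarrow> z ^ (N + K) * of_real (f z * g z) = poly (p * q) z"
        by (simp add: algebra_simps power_add flip: p q)
      then show ?thesis using fg unfolding P_def by (blast intro: continuous_on_mult)
    qed
    show "\<exists>f. P f \<and> f x \<noteq> f y" if "x \<in> sphere 0 1 \<and> y \<in> sphere 0 1 \<and> x \<noteq> y" for x y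
    proof -
      have c: "z * cnj z = 1" if "cmod z = 1" for z
        using that by (metis complex_norm_square of_real_1 power_one)
      have "z ^ 1 * of_real (Re z) = poly [:1/2, 0, 1/2:] z" if "cmod z = 1" for z
        proof -
        have "complex_of_real (Re z) = (z + cnj z) / 2" by (simp add: complex_eq_iff)
        then show ?thesis using c[OF that] by (simp add: field_simps)
      qed
      moreover have "z ^ 1 * of_real (Im z) = poly [:\<i>/2, 0, -\<i>/2:] z" if "cmod z = 1" for z
        proof -
        have "complex_of_real (Im z) = (cnj z - z) * \<i> / 2" by (simp add: complex_eq_iff)
        then have "z * of_real (Im z) = (z * cnj z - z * z) * \<i> / 2" by (simp only:) (simp add: algebra_simps)
        then show ?thesis using c[OF that] by (simp add: algebra_simps)
      qed
      ultimately have "P Re" "P Im"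
        unfolding P_def using continuous_on_Re[OF continuous_on_id] continuous_on_Im[OF continuous_on_id]
        by blast+
      then show ?thesis using that by (metis complex_eq_iff)
    qed
  qed (use assms in \<open>auto simp: P_def\<close>)
  then obtain g N p where g: "\<And>z. cmod z = 1 \<Longrightarrow> \<bar>u z - g z\<bar> < e"
    and p: "\<And>z. cmod z = 1 \<Longrightarrow> z ^ N * of_real (g z) = poly p z"
    unfolding P_def by (metis mem_sphere_0)
  obtain q where q: "\<And>z. cmod z = 1 \<Longrightarrow> Re (cnj z ^ N * poly p z) = Re (poly q z)"
    using Re_laurent_eq_Re_poly[of N p] by blast
  have "g z = Re (poly q z)" if "cmod z = 1" for z
  proof -
    have "cnj z * z = 1" using that by (metis complex_norm_square mult.commute of_real_1 power_one)
    then have "of_real (g z) = cnj z ^ N * poly p z"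
      using p[OF that] by (metis mult.assoc mult_1 power_mult_distrib power_one)
    then show ?thesis using q[OF that] by (metis Re_complex_of_real)
  qed
  then show ?thesis using g that[of q] by simp
qed

text \<open>Indicators are approximated by Urysohn functions between a compact set inside and an open set outside
  that differ by little mass; the general case follows from linearity and dominated convergence.\<close>

lemma ex_continuous_L1_approx:
  fixes f :: "'a::euclidean_space \<Rightarrow> real"
  assumes sets: "sets N = sets borel" and fin: "finite_measure N"
    and f: "integrable N f" and e: "0 < e"
  shows "\<exists>g. continuous_on UNIV g \<and> integrable N g \<and> (\<integral>x. \<bar>f x - g x\<bar> \<partial>N) < e"
  using f e
proof (induction arbitrary: e rule: integrable_induct)
  case (base A c)
  interpret finite_measure N by fact
  have A: "A \<in> sets borel" using base sets by simp
  define d where "d = e / (2 * (\<bar>c\<bar> + 1))"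
  have d: "0 < d" using base by (simp add: d_def)
  have "\<exists>K. K \<subseteq> A \<and> compact K \<and> measure N A - d < measure N K"
  proof (cases "measure N A < d")
    case True
    then show ?thesis by (intro exI[of _ "{}"]) auto
  next
    case False
    then have "ennreal (measure N A - d) < emeasure N A"
      using d by (simp add: emeasure_eq_measure ennreal_less_iff)
    then have "ennreal (measure N A - d) < (SUP K \<in> {K. K \<subseteq> A \<and> compact K}. emeasure N K)"
      using inner_regular[OF sets _ A] by simp
    then obtain K where "K \<subseteq> A" "compact K" "ennreal (measure N A - d) < emeasure N K"
      by (auto simp: less_SUP_iff)
    then show ?thesis using False by (auto simp: emeasure_eq_measure ennreal_less_iff)
  qed
  then obtain K where K: "K \<subseteq> A" "compact K" "measure N A - d < measure N K" by blast
  have "emeasure N A < ennreal (measure N A + d)"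
    using d by (simp add: emeasure_eq_measure ennreal_less_iff)
  then have "(INF U \<in> {U. A \<subseteq> U \<and> open U}. emeasure N U) < ennreal (measure N A + d)"
    using outer_regular[OF sets _ A] by simp
  then obtain U where U: "A \<subseteq> U" "open U" "emeasure N U < ennreal (measure N A + d)"
    by (auto simp: INF_less_iff)
  then have U3: "measure N U < measure N A + d" by (simp add: emeasure_eq_measure ennreal_less_iff)
  have sKU: "K \<in> sets N" "U \<in> sets N" using sets K U by (auto simp: compact_imp_closed)
  have UK: "measure N (U - K) < 2 * d"
    using K(1,3) U(1) U3 sKU finite_measure_Diff[of U K] by auto
  obtain g :: "'a \<Rightarrow> real" where g: "continuous_on UNIV g" "\<And>x. g x \<in> closed_segment 1 0"
      "\<And>x. x \<in> K \<Longrightarrow> g x = 1" "\<And>x. x \<in> - U \<Longrightarrow> g x = 0"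
    using Urysohn[of K "- U" 1 0] K U by (auto simp: compact_imp_closed)
  then have g01: "0 \<le> g x" "g x \<le> 1" for x
    by (metis (no_types) atLeastAtMost_iff closed_segment_commute closed_segment_eq_real_ivl1 zero_le_one)+
  have gm: "g \<in> borel_measurable N"
    using borel_measurable_continuous_onI[OF g(1)] by (simp add: sets cong: measurable_cong_sets)
  have gi: "integrable N (\<lambda>x. g x * c)"
    using gm g01 by (intro integrable_mult_left integrable_const_bound[where B=1]) auto
  have "(\<integral>x. \<bar>indicator A x *\<^sub>R c - g x * c\<bar> \<partial>N) \<le> (\<integral>x. \<bar>c\<bar> * indicator (U - K) x \<partial>N)"
  proof (rule integral_mono)
    show "integrable N (\<lambda>x. \<bar>indicator A x *\<^sub>R c - g x * c\<bar>)"
      using base gi by (intro integrable_abs Bochner_Integration.integrable_diff) (auto simp: less_top)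
    show "integrable N (\<lambda>x. \<bar>c\<bar> * indicator (U - K) x)"
      using sKU by (intro integrable_mult_right) (auto simp: emeasure_eq_measure)
    have "\<bar>indicator A x - g x\<bar> \<le> indicator (U - K) x" for x
      using K(1) U(1) g(3)[of x] g(4)[of x] g01[of x] by (auto simp: indicator_def)
    then have "\<bar>c\<bar> * \<bar>indicator A x - g x\<bar> \<le> \<bar>c\<bar> * indicator (U - K) x" for x
      by (intro mult_left_mono) auto
    then show "\<bar>indicator A x *\<^sub>R c - g x * c\<bar> \<le> \<bar>c\<bar> * indicator (U - K) x" for x
      by (simp add: abs_mult[symmetric] algebra_simps)
  qed
  also have "\<dots> = \<bar>c\<bar> * measure N (U - K)" using sKU by simp
  also have "\<dots> \<le> \<bar>c\<bar> * (2 * d)" using UK by (intro mult_left_mono) auto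
  also have "\<dots> < e" using base by (simp add: d_def field_simps)
  finally show ?case using gi g(1) by (intro exI[of _ "\<lambda>x. g x * c"]) (auto intro!: continuous_intros)
next
  case (add f1 f2)
  obtain g1 g2 where g: "continuous_on UNIV g1" "integrable N g1" "(\<integral>x. \<bar>f1 x - g1 x\<bar> \<partial>N) < e/2"
    "continuous_on UNIV g2" "integrable N g2" "(\<integral>x. \<bar>f2 x - g2 x\<bar> \<partial>N) < e/2"
    using add(3)[of "e/2"] add(4)[of "e/2"] add(5) by auto
  have "(\<integral>x. \<bar>(f1 x + f2 x) - (g1 x + g2 x)\<bar> \<partial>N) \<le> (\<integral>x. \<bar>f1 x - g1 x\<bar> + \<bar>f2 x - g2 x\<bar> \<partial>N)"
    using add(1,2) g by (intro integral_mono) auto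
  also have "\<dots> = (\<integral>x. \<bar>f1 x - g1 x\<bar> \<partial>N) + (\<integral>x. \<bar>f2 x - g2 x\<bar> \<partial>N)"
    using add(1,2) g by (intro Bochner_Integration.integral_add) auto
  also have "\<dots> < e" using g by simp
  finally show ?case using g by (intro exI[of _ "\<lambda>x. g1 x + g2 x"]) (auto intro!: continuous_intros)
next
  case (lim f s)
  have "(\<lambda>i. \<integral>x. \<bar>f x - s i x\<bar> \<partial>N) \<longlonglongrightarrow> (\<integral>x. 0 \<partial>N)"
  proof (rule integral_dominated_convergence)
    show "integrable N (\<lambda>x. 3 * \<bar>f x\<bar>)" using lim by auto
    show "AE x in N. (\<lambda>i. \<bar>f x - s i x\<bar>) \<longlonglongrightarrow> 0"
    proof (rule AE_I2)
      fix x assume "x \<in> space N"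
      then have "(\<lambda>i. \<bar>f x - s i x\<bar>) \<longlonglongrightarrow> \<bar>f x - f x\<bar>"
        using lim by (intro tendsto_intros) auto
      then show "(\<lambda>i. \<bar>f x - s i x\<bar>) \<longlonglongrightarrow> 0" by simp
    qed
    show "AE x in N. norm \<bar>f x - s i x\<bar> \<le> 3 * \<bar>f x\<bar>" for i
    proof (rule AE_I2)
      fix x assume "x \<in> space N"
      then have "\<bar>s i x\<bar> \<le> 2 * \<bar>f x\<bar>" using lim by simp
      then show "norm \<bar>f x - s i x\<bar> \<le> 3 * \<bar>f x\<bar>" by (simp add: abs_if split: if_splits)
    qed
  qed (use lim in auto)
  then have "\<forall>\<^sub>F i in sequentially. (\<integral>x. \<bar>f x - s i x\<bar> \<partial>N) < e / 2"
    using \<open>0 < e\<close> by (intro order_tendstoD(2)) auto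
  then obtain i where i: "(\<integral>x. \<bar>f x - s i x\<bar> \<partial>N) < e / 2" by (meson eventually_sequentially order_refl)
  obtain g where g: "continuous_on UNIV g" "integrable N g" "(\<integral>x. \<bar>s i x - g x\<bar> \<partial>N) < e/2"
    using lim.IH[of "e/2" i] \<open>0 < e\<close> by auto
  have "(\<integral>x. \<bar>f x - g x\<bar> \<partial>N) \<le> (\<integral>x. \<bar>f x - s i x\<bar> + \<bar>s i x - g x\<bar> \<partial>N)"
    using lim g by (intro integral_mono) auto
  also have "\<dots> = (\<integral>x. \<bar>f x - s i x\<bar> \<partial>N) + (\<integral>x. \<bar>s i x - g x\<bar> \<partial>N)"
    using lim g by (intro Bochner_Integration.integral_add) auto
  also have "\<dots> < e" using g i by simp
  finally show ?case using g by blast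
qed

lemma Arg2pi_cis: "\<theta> \<in> {0..<2*pi} \<Longrightarrow> Arg2pi (cis \<theta>) = \<theta>"
  using Arg2pi_unique[of 1 \<theta> "cis \<theta>"] by (simp add: cis_conv_exp)

lemma measurable_Arg2pi: "Arg2pi \<in> borel \<rightarrow>\<^sub>M restrict_space borel {0..<2*pi}"
proof (rule measurable_restrict_space2)
  have "{z. t < Arg2pi z} \<in> sets borel" for t
    using open_Arg2pi2pi_gt by (rule borel_open)
  then show "Arg2pi \<in> borel_measurable borel" by (simp add: borel_measurable_iff_greater)
qed (use Arg2pi in auto)

section \<open>The upper bound in Szego's theorem\<close>

text \<open>The squared distance in \<open>L\<^sup>2(\<nu>)\<close> from the constant 1 to the span of \<open>z, z\<^sup>2, \<dots>\<close>.\<close>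

definition szego_infimum :: "real measure \<Rightarrow> real" where
  "szego_infimum \<nu> = (INF p\<in>{p. poly p 0 = 1}. \<integral>\<theta>. (cmod (poly p (cis \<theta>)))\<^sup>2 \<partial>\<nu>)"

lemma szego_infimum_le:
  assumes "poly p 0 = 1"
  shows "szego_infimum \<nu> \<le> (\<integral>\<theta>. (cmod (poly p (cis \<theta>)))\<^sup>2 \<partial>\<nu>)"
  unfolding szego_infimum_def using assms by (intro cINF_lower bdd_belowI2[of _ 0]) auto

lemma szego_infimum_nonneg: "0 \<le> szego_infimum \<nu>"
  unfolding szego_infimum_def by (intro cINF_greatest) (auto intro: exI[of _ 1])

text \<open>If \<open>f\<close> vanishes at the origin, then the partial sums of the exponential series of \<open>f\<close> are polynomials with
  value 1 at the origin, so \<open>exp f\<close> may be used as a competitor although it is not a polynomial. This is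
  how exponentials of arbitrary trigonometric polynomials of mean zero enter the extremal problem.\<close>

lemma szego_infimum_le_exp_poly:
  assumes \<nu>: "torus_measure \<nu>" and f0: "poly f 0 = 0"
  shows "szego_infimum \<nu> \<le> (\<integral>\<theta>. exp (2 * Re (poly f (cis \<theta>))) \<partial>\<nu>)"
proof -
  define P where "P N = (\<Sum>k\<le>N. smult (1 / fact k) (f ^ k))" for N
  have poly_P: "poly (P N) z = (\<Sum>k\<le>N. poly f z ^ k /\<^sub>R fact k)" for N z
    by (simp add: P_def poly_sum scaleR_conv_of_real divide_inverse)
  have "poly (P N) 0 = 1" for N
    by (simp add: poly_P f0 power_0_left if_distrib[of "\<lambda>x. x /\<^sub>R _"] sum.delta cong: if_cong)
  then have le: "szego_infimum \<nu> \<le> (\<integral>\<theta>. (cmod (poly (P N) (cis \<theta>)))\<^sup>2 \<partial>\<nu>)" for N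
    by (rule szego_infimum_le)
  have lim: "(\<lambda>N. (cmod (poly (P N) z))\<^sup>2) \<longlonglongrightarrow> exp (2 * Re (poly f z))" for z
  proof -
    have "(\<lambda>N. poly (P N) z) \<longlonglongrightarrow> exp (poly f z)"
      using exp_converges[of "poly f z"] unfolding poly_P sums_def_le .
    then have "(\<lambda>N. (cmod (poly (P N) z))\<^sup>2) \<longlonglongrightarrow> (cmod (exp (poly f z)))\<^sup>2"
      by (intro tendsto_intros)
    then show ?thesis by (simp add: exp_double)
  qed
  have bound: "(cmod (poly (P N) z))\<^sup>2 \<le> (exp (cmod (poly f z)))\<^sup>2" for N z
  proof (rule power_mono)
    have "cmod (poly (P N) z) \<le> (\<Sum>k\<le>N. cmod (poly f z) ^ k /\<^sub>R fact k)"
      unfolding poly_P by (rule order_trans[OF norm_sum]) (simp add: norm_power)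
    also have "\<dots> \<le> (\<Sum>k. cmod (poly f z) ^ k /\<^sub>R fact k)"
      by (intro sum_le_suminf summable_exp_generic) auto
    finally show "cmod (poly (P N) z) \<le> exp (cmod (poly f z))" by (simp add: exp_def)
  qed simp
  have "(\<lambda>N. \<integral>\<theta>. (cmod (poly (P N) (cis \<theta>)))\<^sup>2 \<partial>\<nu>)
      \<longlonglongrightarrow> (\<integral>\<theta>. exp (2 * Re (poly f (cis \<theta>))) \<partial>\<nu>)"
  proof (rule integral_dominated_convergence)
    show "integrable \<nu> (\<lambda>\<theta>. (exp (cmod (poly f (cis \<theta>))))\<^sup>2)"
      using integrable_torus_continuous[OF \<nu>, of "\<lambda>z. (exp (cmod (poly f z)))\<^sup>2"]
      by (simp add: continuous_intros)
    show "(\<lambda>\<theta>. (cmod (poly (P N) (cis \<theta>)))\<^sup>2) \<in> borel_measurable \<nu>" for N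
      using integrable_torus_continuous[OF \<nu>, of "\<lambda>z. (cmod (poly (P N) z))\<^sup>2"]
      by (simp add: continuous_intros borel_measurable_integrable)
    show "(\<lambda>\<theta>. exp (2 * Re (poly f (cis \<theta>)))) \<in> borel_measurable \<nu>"
      using integrable_torus_continuous[OF \<nu>, of "\<lambda>z. exp (2 * Re (poly f z))"]
      by (simp add: continuous_intros borel_measurable_integrable)
  qed (use lim bound in auto)
  then show ?thesis by (rule LIMSEQ_le_const) (use le in blast)
qed

text \<open>Any real continuous \<open>u\<close> is uniformly close to the real part of a polynomial, whose value at the origin
  is close to the mean of \<open>u\<close>.\<close>

lemma szego_infimum_le_exp_continuous:
  fixes u :: "complex \<Rightarrow> real"
  assumes \<nu>: "torus_measure \<nu>" and u: "continuous_on UNIV u"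
  shows "szego_infimum \<nu> * exp (\<integral>\<theta>. u (cis \<theta>) \<partial>torus_haar) \<le> (\<integral>\<theta>. exp (u (cis \<theta>)) \<partial>\<nu>)"
    (is "?S * exp ?m \<le> ?I")
proof -
  have "?S * exp ?m \<le> exp (2 * e) * ?I" if "0 < e" for e
  proof -
    interpret m: prob_space torus_haar by (rule prob_space_haar)
    obtain p where p: "\<And>z. cmod z = 1 \<Longrightarrow> \<bar>u z - Re (poly p z)\<bar> < e"
      using ex_poly_Re_approx[of u e] u \<open>0 < e\<close> by (metis continuous_on_subset subset_UNIV)
    have p': "Re (poly p (cis \<theta>)) - e \<le> u (cis \<theta>)" "u (cis \<theta>) \<le> Re (poly p (cis \<theta>)) + e" for \<theta>
      using p[of "cis \<theta>"] by (simp_all add: abs_if split: if_splits)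
    \<comment> \<open>The factor 1/2 compensates for \<open>\<bar>exp f\<bar>\<^sup>2 = exp (2 Re f)\<close>.\<close>
    define f where "f = smult (1/2) (p - [:poly p 0:])"
    have "?m \<le> (\<integral>\<theta>. Re (poly p (cis \<theta>)) + e \<partial>torus_haar)"
      using integrable_torus_continuous[OF torus_measure_haar, of "\<lambda>z. Re (poly p z) + e"] p'
      by (intro integral_mono integrable_torus_continuous[OF torus_measure_haar u])
         (simp_all add: continuous_intros)
    also have "\<dots> = (\<integral>\<theta>. Re (poly p (cis \<theta>)) \<partial>torus_haar) + e"
      using integrable_torus_continuous[OF torus_measure_haar, of "\<lambda>z. Re (poly p z)"]
      by (simp add: continuous_intros m.prob_space)
    also have "(\<integral>\<theta>. Re (poly p (cis \<theta>)) \<partial>torus_haar) = Re (poly p 0)"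
      using integrable_torus_continuous[OF torus_measure_haar, of "poly p"]
      by (simp add: continuous_intros integral_haar_poly)
    finally have m: "?m \<le> Re (poly p 0) + e" .
    have "?S \<le> (\<integral>\<theta>. exp (2 * Re (poly f (cis \<theta>))) \<partial>\<nu>)"
      by (rule szego_infimum_le_exp_poly[OF \<nu>]) (simp add: f_def)
    also have "\<dots> \<le> (\<integral>\<theta>. exp (e - Re (poly p 0)) * exp (u (cis \<theta>)) \<partial>\<nu>)"
      using integrable_torus_continuous[OF \<nu>, of "\<lambda>z. exp (2 * Re (poly f z))"]
        integrable_torus_continuous[OF \<nu>, of "\<lambda>z. exp (e - Re (poly p 0)) * exp (u z)"] p'
      by (intro integral_mono) (simp_all add: continuous_intros u f_def algebra_simps flip: exp_add)
    also have "\<dots> = exp (e - Re (poly p 0)) * ?I" by simp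
    finally have "?S * exp ?m \<le> exp (e - Re (poly p 0)) * ?I * exp ?m"
      by (intro mult_right_mono) auto
    also have "\<dots> \<le> exp (e - Re (poly p 0)) * ?I * exp (Re (poly p 0) + e)"
      using m by (intro mult_left_mono) auto
    also have "\<dots> = exp (2 * e) * ?I" by (simp add: algebra_simps flip: exp_add)
    finally show ?thesis .
  qed
  then have "\<forall>\<^sub>F e in at_right 0. ?S * exp ?m \<le> exp (2 * e) * ?I"
    by (simp add: eventually_at_right_less eventually_at_filter)
  moreover have "((\<lambda>e. exp (2 * e) * ?I) \<longlongrightarrow> exp (2 * 0) * ?I) (at_right 0)"
    by (intro tendsto_intros)
  ultimately show ?thesis
    by (intro tendsto_lowerbound[of _ _ "at_right (0::real)"]) auto
qed

lemma abs_exp_diff_le: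
  fixes a b :: real
  assumes "\<bar>a\<bar> \<le> C" "\<bar>b\<bar> \<le> C"
  shows "\<bar>exp a - exp b\<bar> \<le> exp C * \<bar>a - b\<bar>"
proof -
  have *: "exp y - exp x \<le> exp C * (y - x)" if "x \<le> y" "y \<le> C" for x y :: real
  proof -
    have "exp y * (1 - exp (x - y)) \<le> exp y * (y - x)"
      using exp_ge_add_one_self[of "x - y"] by (intro mult_left_mono; linarith?) simp
    also have "\<dots> \<le> exp C * (y - x)" using that by (intro mult_right_mono) auto
    finally show ?thesis by (simp add: algebra_simps flip: exp_add)
  qed
  have "a \<le> C" "b \<le> C" using assms by (auto dest: abs_le_D1)
  then show ?thesis using *[of a b] *[of b a] by (cases "a \<le> b") (simp_all add: abs_if)
qed

text \<open>The inequality passes from continuous to bounded Borel functions by approximation in \<open>L\<^sup>1\<close>. The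
  approximant has to be good for \<open>\<nu>\<close> on the right and for Haar measure on the left, hence the sum of the
  two; it is transported to the plane along \<open>cis\<close>, where continuous functions are automatically
  periodic.\<close>

lemma szego_infimum_le_exp_bounded:
  assumes \<nu>: "torus_measure \<nu>" and u: "u \<in> borel_measurable \<nu>" and C: "\<And>\<theta>. \<bar>u \<theta>\<bar> \<le> C"
  shows "szego_infimum \<nu> * exp (\<integral>\<theta>. u \<theta> \<partial>torus_haar) \<le> (\<integral>\<theta>. exp (u \<theta>) \<partial>\<nu>)"
proof -
  let ?m = "torus_haar"
  have setseq: "sets \<nu> = sets ?m" "sets ?m = sets (restrict_space borel {0..<2*pi})"
    using \<nu> torus_measure_haar by (simp_all add: torus_measure_def)
  interpret \<nu>: finite_measure \<nu> using \<nu> by (simp add: torus_measure_def)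
  interpret m: prob_space ?m by (rule prob_space_haar)
  obtain N where N: "sets N = sets ?m" "finite_measure N"
    "\<And>S. S \<in> sets N \<Longrightarrow> emeasure N S = emeasure \<nu> S + emeasure ?m S"
    using ex_add_measure[OF setseq(1) \<nu>.finite_measure_axioms m.finite_measure_axioms] by blast
  interpret N: finite_measure N by fact
  have tN: "torus_measure N" using N setseq by (simp add: torus_measure_def)
  have um: "u \<in> borel_measurable N" "u \<in> borel_measurable ?m" "u \<in> borel_measurable (restrict_space borel {0..<2*pi})"
    using u by (simp_all add: setseq N(1) cong: measurable_cong_sets)
  define D where "D = distr N borel cis"
  interpret D: finite_measure D
    unfolding D_def by (rule N.finite_measure_distr[OF measurable_cis_torus_measure[OF tN]])
  define U where "U z = u (Arg2pi z)" for z
  have Um: "U \<in> borel_measurable borel"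
    unfolding U_def by (rule measurable_compose[OF measurable_Arg2pi um(3)])
  have Ui: "integrable D U"
    using C Um by (intro D.integrable_const_bound[where B=C]) (auto simp: D_def U_def)
  let ?S = "szego_infimum \<nu>" and ?I = "\<integral>\<theta>. exp (u \<theta>) \<partial>\<nu>" and ?M = "\<integral>\<theta>. u \<theta> \<partial>?m"
  have "?S * exp (?M - e) \<le> ?I + exp C * e" if e: "0 < e" for e
  proof -
    obtain g0 where g0: "continuous_on UNIV g0" "integrable D g0" "(\<integral>z. \<bar>U z - g0 z\<bar> \<partial>D) < e"
      using ex_continuous_L1_approx[OF _ D.finite_measure_axioms Ui e] by (auto simp: D_def)
    \<comment> \<open>Truncation does not increase the distance to \<open>U\<close> and keeps the Lipschitz constant of \<open>exp\<close> under control.\<close>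
    define g where "g z = max (- C) (min C (g0 z))" for z
    have gc: "continuous_on UNIV g" unfolding g_def using g0 by (intro continuous_intros)
    have C0: "0 \<le> C" using C[of 0] by simp
    have gC: "\<bar>g z\<bar> \<le> C" for z using C0 by (auto simp: g_def)
    have gm: "g \<in> borel_measurable borel" by (rule borel_measurable_continuous_onI[OF gc])
    have gi: "integrable D g"
      using gC gm by (intro D.integrable_const_bound[where B=C]) (auto simp: D_def)
    have "\<bar>U z - g z\<bar> \<le> \<bar>U z - g0 z\<bar>" for z
      using C[of "Arg2pi z"] by (auto simp: g_def U_def)
    then have "(\<integral>z. \<bar>U z - g z\<bar> \<partial>D) \<le> (\<integral>z. \<bar>U z - g0 z\<bar> \<partial>D)"
      using Ui g0 gi
      by (intro integral_mono integrable_abs Bochner_Integration.integrable_diff) auto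
    then have "(\<integral>z. \<bar>U z - g z\<bar> \<partial>D) < e" using g0 by simp
    also have "(\<integral>z. \<bar>U z - g z\<bar> \<partial>D) = (\<integral>\<theta>. \<bar>U (cis \<theta>) - g (cis \<theta>)\<bar> \<partial>N)"
      unfolding D_def using Um gm
      by (intro integral_distr measurable_cis_torus_measure[OF tN]) auto
    also have "\<dots> = (\<integral>\<theta>. \<bar>u \<theta> - g (cis \<theta>)\<bar> \<partial>N)"
      using space_torus_measure[OF tN]
      by (intro Bochner_Integration.integral_cong) (auto simp: U_def Arg2pi_cis)
    finally have Ne: "(\<integral>\<theta>. \<bar>u \<theta> - g (cis \<theta>)\<bar> \<partial>N) < e" .
    have gcis: "(\<lambda>\<theta>. g (cis \<theta>)) \<in> borel_measurable K" if "torus_measure K" for K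
      using measurable_compose[OF measurable_cis_torus_measure[OF that] gm] .
    have int: "integrable K (\<lambda>\<theta>. \<bar>u \<theta> - g (cis \<theta>)\<bar>)" "integrable K (\<lambda>\<theta>. u \<theta>)"
        "integrable K (\<lambda>\<theta>. g (cis \<theta>))" "integrable K (\<lambda>\<theta>. exp (u \<theta>))"
        "integrable K (\<lambda>\<theta>. exp (g (cis \<theta>)))"
      if "torus_measure K" "u \<in> borel_measurable K" for K
    proof -
      interpret K: finite_measure K using that by (simp add: torus_measure_def)
      have b: "\<bar>u \<theta>\<bar> \<le> C" "\<bar>g (cis \<theta>)\<bar> \<le> C" for \<theta> using C gC by auto
      then have b': "u \<theta> \<le> C" "g (cis \<theta>) \<le> C" for \<theta> by (metis abs_le_D1)+
      show u: "integrable K (\<lambda>\<theta>. u \<theta>)" "integrable K (\<lambda>\<theta>. g (cis \<theta>))"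
        using b that gcis[OF that(1)] by (auto intro!: K.integrable_const_bound[where B=C])
      then show "integrable K (\<lambda>\<theta>. \<bar>u \<theta> - g (cis \<theta>)\<bar>)" by simp
      show "integrable K (\<lambda>\<theta>. exp (u \<theta>))" "integrable K (\<lambda>\<theta>. exp (g (cis \<theta>)))"
        using b' that gcis[OF that(1)] by (auto intro!: K.integrable_const_bound[where B="exp C"])
    qed
    note int\<nu> = int[OF \<nu> u] and intm = int[OF torus_measure_haar um(2)] and intN = int[OF tN um(1)]
    have "(\<integral>\<^sup>+\<theta>. ennreal \<bar>u \<theta> - g (cis \<theta>)\<bar> \<partial>N)
        = (\<integral>\<^sup>+\<theta>. ennreal \<bar>u \<theta> - g (cis \<theta>)\<bar> \<partial>\<nu>) + (\<integral>\<^sup>+\<theta>. ennreal \<bar>u \<theta> - g (cis \<theta>)\<bar> \<partial>?m)"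
      using N setseq intN(1) by (intro nn_integral_add_measure) auto
    then have "(\<integral>\<theta>. \<bar>u \<theta> - g (cis \<theta>)\<bar> \<partial>N)
        = (\<integral>\<theta>. \<bar>u \<theta> - g (cis \<theta>)\<bar> \<partial>\<nu>) + (\<integral>\<theta>. \<bar>u \<theta> - g (cis \<theta>)\<bar> \<partial>?m)"
      using int\<nu>(1) intm(1) intN(1)
      by (simp add: nn_integral_eq_integral flip: ennreal_plus)
    moreover have "0 \<le> (\<integral>\<theta>. \<bar>u \<theta> - g (cis \<theta>)\<bar> \<partial>\<nu>)" "0 \<le> (\<integral>\<theta>. \<bar>u \<theta> - g (cis \<theta>)\<bar> \<partial>?m)" by simp_all
    ultimately have err: "(\<integral>\<theta>. \<bar>u \<theta> - g (cis \<theta>)\<bar> \<partial>\<nu>) \<le> e" "(\<integral>\<theta>. \<bar>u \<theta> - g (cis \<theta>)\<bar> \<partial>?m) \<le> e"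
      using Ne by linarith+
    have "?M - (\<integral>\<theta>. g (cis \<theta>) \<partial>?m) = (\<integral>\<theta>. u \<theta> - g (cis \<theta>) \<partial>?m)"
      using intm by simp
    also have "\<dots> \<le> (\<integral>\<theta>. \<bar>u \<theta> - g (cis \<theta>)\<bar> \<partial>?m)" using intm by (intro integral_mono) auto
    finally have "?M - e \<le> (\<integral>\<theta>. g (cis \<theta>) \<partial>?m)" using err by simp
    then have "?S * exp (?M - e) \<le> ?S * exp (\<integral>\<theta>. g (cis \<theta>) \<partial>?m)"
      using szego_infimum_nonneg by (intro mult_left_mono) auto
    also have "\<dots> \<le> (\<integral>\<theta>. exp (g (cis \<theta>)) \<partial>\<nu>)" by (rule szego_infimum_le_exp_continuous[OF \<nu> gc])
    also have "\<dots> \<le> (\<integral>\<theta>. exp (u \<theta>) + exp C * \<bar>u \<theta> - g (cis \<theta>)\<bar> \<partial>\<nu>)"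
    proof (rule integral_mono)
      show "exp (g (cis \<theta>)) \<le> exp (u \<theta>) + exp C * \<bar>u \<theta> - g (cis \<theta>)\<bar>" for \<theta>
        using abs_exp_diff_le[OF C[of \<theta>] gC[of "cis \<theta>"]] by linarith
    qed (use int\<nu> in auto)
    also have "\<dots> = ?I + exp C * (\<integral>\<theta>. \<bar>u \<theta> - g (cis \<theta>)\<bar> \<partial>\<nu>)" using int\<nu> by simp
    also have "\<dots> \<le> ?I + exp C * e" using err by simp
    finally show ?thesis .
  qed
  then have "\<forall>\<^sub>F e in at_right 0. ?S * exp (?M - e) \<le> ?I + exp C * e"
    by (simp add: eventually_at_filter)
  moreover have "((\<lambda>e. ?I + exp C * e) \<longlongrightarrow> ?I + exp C * 0) (at_right 0)"
    "((\<lambda>e. ?S * exp (?M - e)) \<longlongrightarrow> ?S * exp (?M - 0)) (at_right 0)"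
    by (intro tendsto_intros)+
  ultimately show ?thesis
    using tendsto_le[of "at_right (0::real)"] by force
qed

lemma lebesgue_decomposition_nn_integral:
  assumes \<nu>: "torus_measure \<nu>" and dec: "lebesgue_decomposition \<nu> w \<nu>s"
    and f: "f \<in> borel_measurable \<nu>"
  shows "(\<integral>\<^sup>+\<theta>. f \<theta> \<partial>\<nu>) = (\<integral>\<^sup>+\<theta>. ennreal (w \<theta>) * f \<theta> \<partial>torus_haar) + (\<integral>\<^sup>+\<theta>. f \<theta> \<partial>\<nu>s)"
proof -
  have sets: "sets torus_haar = sets \<nu>" "sets \<nu>s = sets \<nu>"
    using \<nu> dec torus_measure_haar by (simp_all add: torus_measure_def lebesgue_decomposition_def)
  have "(\<integral>\<^sup>+\<theta>. f \<theta> \<partial>\<nu>)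
      = (\<integral>\<^sup>+\<theta>. f \<theta> \<partial>density torus_haar (\<lambda>\<theta>. ennreal (w \<theta>))) + (\<integral>\<^sup>+\<theta>. f \<theta> \<partial>\<nu>s)"
    using sets dec f by (intro nn_integral_add_measure) (auto simp: lebesgue_decomposition_def)
  also have "(\<integral>\<^sup>+\<theta>. f \<theta> \<partial>density torus_haar (\<lambda>\<theta>. ennreal (w \<theta>)))
      = (\<integral>\<^sup>+\<theta>. ennreal (w \<theta>) * f \<theta> \<partial>torus_haar)"
    using dec f by (intro nn_integral_density)
      (auto simp: lebesgue_decomposition_def sets cong: measurable_cong_sets)
  finally show ?thesis .
qed

lemma lebesgue_decomposition_integrable:
  assumes \<nu>: "torus_measure \<nu>" and dec: "lebesgue_decomposition \<nu> w \<nu>s"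
  shows "integrable torus_haar w"
proof (rule integrableI_nonneg)
  interpret finite_measure \<nu> using \<nu> by (simp add: torus_measure_def)
  have "(\<integral>\<^sup>+\<theta>. ennreal (w \<theta>) \<partial>torus_haar) \<le> (\<integral>\<^sup>+\<theta>. 1 \<partial>\<nu>)"
    using lebesgue_decomposition_nn_integral[OF \<nu> dec, of "\<lambda>_. 1"] by simp
  then show "(\<integral>\<^sup>+\<theta>. ennreal (w \<theta>) \<partial>torus_haar) < \<infinity>"
    by (simp add: emeasure_eq_measure) (meson ennreal_less_top le_less_trans)
qed (use dec in \<open>auto simp: lebesgue_decomposition_def\<close>)

text \<open>The positive part of the logarithm; it vanishes at arguments where \<open>ln\<close> has only a default value.\<close>

definition ln_plus :: "real \<Rightarrow> real" where
  "ln_plus x = (if 1 < x then ln x else 0)"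

lemma ln_plus_nonneg [simp]: "0 \<le> ln_plus x"
  by (simp add: ln_plus_def)

lemma ln_plus_le: "ln_plus x \<le> \<bar>x\<bar>"
  using ln_le_minus_one[of x] by (cases "1 < x") (auto simp: ln_plus_def)

lemma measurable_ln_plus [measurable]: "ln_plus \<in> borel_measurable borel"
  unfolding ln_plus_def[abs_def] by measurable

lemma integrable_ln_plus: "integrable M w \<Longrightarrow> integrable M (\<lambda>x. ln_plus (w x))"
  by (rule Bochner_Integration.integrable_bound[of M w]) (use ln_plus_le in auto)

lemma e2ennreal_log_ereal: "e2ennreal (log_ereal x) = ennreal (ln_plus x)"
  by (auto simp: log_ereal_def ln_plus_def e2ennreal_neg ennreal_neg)

lemma e2ennreal_minus_log_ereal:
  "e2ennreal (- log_ereal x) = (if 0 < x then ennreal (- ln x) else \<top>)"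
  by (auto simp: log_ereal_def)

lemma measurable_e2ennreal_minus_log_ereal [measurable]:
  "(\<lambda>x. e2ennreal (- log_ereal x)) \<in> borel_measurable borel"
  unfolding e2ennreal_minus_log_ereal by measurable

lemma ereal_integral_log:
  assumes "integrable M w"
  shows "ereal_integral M (\<lambda>x. log_ereal (w x))
    = ereal (\<integral>x. ln_plus (w x) \<partial>M) - enn2ereal (\<integral>\<^sup>+x. e2ennreal (- log_ereal (w x)) \<partial>M)"
  using integrable_ln_plus[OF assms]
  by (simp add: ereal_integral_def e2ennreal_log_ereal nn_integral_eq_integral enn2ereal_ennreal)

lemma exp_ereal_infinity [simp]: "exp_ereal \<infinity> = \<infinity>" "exp_ereal (- \<infinity>) = 0"
  using exp_ereal.simps(2,3) by (simp_all only: PInfty_eq_infinity MInfty_eq_minfinity)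

lemma exp_ereal_nonneg: "0 \<le> exp_ereal x"
  by (cases x) auto

lemma exp_ereal_mono: "x \<le> y \<Longrightarrow> exp_ereal x \<le> exp_ereal y"
  by (cases x; cases y) auto

text \<open>Up to a constant, the optimal exponent would be \<open>- ln w\<close> almost everywhere and \<open>-\<infinity>\<close> on the null set that carries the
  singular part. Cutting it off at \<open>n\<close> makes it bounded: the singular part then costs only a factor
  \<open>exp (- n)\<close>, while \<open>w\<close> divided by its clipped version is at most \<open>1 + w / n\<close>.\<close>

lemma szego_infimum_le_exp_clip:
  assumes \<nu>: "torus_measure \<nu>" and dec: "lebesgue_decomposition \<nu> w \<nu>s" and n: "1 \<le> (n::nat)"
  shows "szego_infimum \<nu> \<le> exp (\<integral>\<theta>. ln (min (max (w \<theta>) (1 / n)) n) \<partial>torus_haar)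
      * (1 + (\<integral>\<theta>. w \<theta> \<partial>torus_haar) / n + exp (- real n) * measure \<nu>s (space \<nu>s))"
proof -
  let ?m = "torus_haar"
  have sets: "sets ?m = sets \<nu>" "sets \<nu>s = sets \<nu>" and ts: "torus_measure \<nu>s"
    using \<nu> dec torus_measure_haar by (simp_all add: torus_measure_def lebesgue_decomposition_def)
  have spaces: "space ?m = space \<nu>" "space \<nu>s = space \<nu>"
    using sets sets_eq_imp_space_eq by blast+
  interpret \<nu>: finite_measure \<nu> using \<nu> by (simp add: torus_measure_def)
  interpret \<nu>s: finite_measure \<nu>s using ts by (simp add: torus_measure_def)
  interpret m: prob_space ?m by (rule prob_space_haar)
  have wm: "w \<in> borel_measurable ?m" and w0: "AE \<theta> in ?m. 0 \<le> w \<theta>"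
    using dec by (auto simp: lebesgue_decomposition_def)
  have wi: "integrable ?m w" by (rule lebesgue_decomposition_integrable[OF \<nu> dec])
  obtain N where N: "N \<in> sets ?m" "emeasure ?m N = 0" "emeasure \<nu>s (space ?m - N) = 0"
    using dec by (auto simp: lebesgue_decomposition_def mutually_singular_def)
  have AE1: "AE \<theta> in ?m. \<theta> \<notin> N" using N by (intro AE_not_in) (auto simp: null_sets_def)
  have AE2: "AE \<theta> in \<nu>s. \<theta> \<in> N"
    using N sets by (intro AE_I[of _ _ "space ?m - N"]) (auto simp: spaces)
  define f where "f \<theta> = min (max (w \<theta>) (1 / n)) n" for \<theta>
  define u where "u \<theta> = (if \<theta> \<in> N then - real n else - ln (f \<theta>))" for \<theta>
  have f: "1 / n \<le> f \<theta>" "f \<theta> \<le> n" "0 < f \<theta>" for \<theta>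
  proof -
    have n': "1 \<le> real n" "1 / real n \<le> 1" "0 < 1 / real n" using n by auto
    show "1 / n \<le> f \<theta>" "f \<theta> \<le> n" "0 < f \<theta>" unfolding f_def using n' by linarith+
  qed
  have ub: "\<bar>u \<theta>\<bar> \<le> n" for \<theta>
  proof -
    have "ln (f \<theta>) \<le> ln n" using f n by (intro ln_mono) auto
    moreover have "- ln n \<le> ln (f \<theta>)"
      using f n ln_mono[of "1/n" "f \<theta>"] by (simp add: ln_div)
    moreover have "ln n \<le> real n - 1" using n by (intro ln_le_minus_one) auto
    ultimately show ?thesis by (auto simp: u_def)
  qed
  have um: "u \<in> borel_measurable ?m"
    unfolding u_def f_def using wm N(1) by measurable
  then have um\<nu>: "u \<in> borel_measurable \<nu>" by (simp add: sets cong: measurable_cong_sets)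
  have ms: "szego_infimum \<nu> * exp (\<integral>\<theta>. u \<theta> \<partial>?m) \<le> (\<integral>\<theta>. exp (u \<theta>) \<partial>\<nu>)"
    by (rule szego_infimum_le_exp_bounded[OF \<nu> um\<nu> ub])
  have "(\<integral>\<theta>. u \<theta> \<partial>?m) = (\<integral>\<theta>. - ln (f \<theta>) \<partial>?m)"
  proof (rule integral_cong_AE[OF um])
    show "(\<lambda>\<theta>. - ln (f \<theta>)) \<in> borel_measurable ?m" unfolding f_def using wm by measurable
    show "AE \<theta> in ?m. u \<theta> = - ln (f \<theta>)" using AE1 by eventually_elim (simp add: u_def)
  qed
  then have iu: "(\<integral>\<theta>. u \<theta> \<partial>?m) = - (\<integral>\<theta>. ln (f \<theta>) \<partial>?m)" by simp
  have bound: "(\<integral>\<theta>. exp (u \<theta>) \<partial>\<nu>)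
      \<le> 1 + (\<integral>\<theta>. w \<theta> \<partial>?m) / n + exp (- real n) * measure \<nu>s (space \<nu>s)" (is "_ \<le> ?b")
  proof -
    have "ennreal (\<integral>\<theta>. exp (u \<theta>) \<partial>\<nu>) = (\<integral>\<^sup>+\<theta>. ennreal (exp (u \<theta>)) \<partial>\<nu>)"
    proof (rule nn_integral_eq_integral[symmetric])
      have "exp (u \<theta>) \<le> exp n" for \<theta> using ub[of \<theta>] by auto
      then show "integrable \<nu> (\<lambda>\<theta>. exp (u \<theta>))"
        using um\<nu> by (intro \<nu>.integrable_const_bound[where B="exp n"]) auto
    qed simp
    also have "\<dots> = (\<integral>\<^sup>+\<theta>. ennreal (w \<theta>) * ennreal (exp (u \<theta>)) \<partial>?m) + (\<integral>\<^sup>+\<theta>. ennreal (exp (u \<theta>)) \<partial>\<nu>s)"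
      using um\<nu> by (intro lebesgue_decomposition_nn_integral[OF \<nu> dec]) auto
    also have "\<dots> \<le> (\<integral>\<^sup>+\<theta>. ennreal (1 + w \<theta> / n) \<partial>?m) + (\<integral>\<^sup>+\<theta>. ennreal (exp (- real n)) \<partial>\<nu>s)"
    proof (intro add_mono nn_integral_mono_AE)
      show "AE \<theta> in ?m. ennreal (w \<theta>) * ennreal (exp (u \<theta>)) \<le> ennreal (1 + w \<theta> / n)"
        using AE1 w0
      proof eventually_elim
        fix \<theta> assume \<theta>: "\<theta> \<notin> N" "0 \<le> w \<theta>"
        then have "w \<theta> * exp (u \<theta>) = w \<theta> / f \<theta>" using f(3)[of \<theta>] by (simp add: u_def exp_minus field_simps)
        also have "\<dots> \<le> 1 + w \<theta> / n"
        proof (cases "w \<theta> \<le> n")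
          case True
          then have "w \<theta> \<le> f \<theta>" by (simp add: f_def)
          then have "w \<theta> / f \<theta> \<le> 1" using f(3)[of \<theta>] by simp
          then show ?thesis using \<theta> by (simp add: add_increasing2)
        next
          case False
          moreover have "1 \<le> real n" "1 / real n \<le> 1" using n by auto
          ultimately have "f \<theta> = n" unfolding f_def by linarith
          then show ?thesis by simp
        qed
        finally show "ennreal (w \<theta>) * ennreal (exp (u \<theta>)) \<le> ennreal (1 + w \<theta> / n)"
          using \<theta> by (subst ennreal_mult[symmetric]) (auto intro!: ennreal_leI simp del: ennreal_plus)
      qed
      show "AE \<theta> in \<nu>s. ennreal (exp (u \<theta>)) \<le> ennreal (exp (- real n))"
        using AE2 by eventually_elim (simp add: u_def)
    qed
    also have "(\<integral>\<^sup>+\<theta>. ennreal (1 + w \<theta> / n) \<partial>?m) = ennreal (1 + (\<integral>\<theta>. w \<theta> \<partial>?m) / n)"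
    proof (subst nn_integral_eq_integral)
      show "AE \<theta> in ?m. 0 \<le> 1 + w \<theta> / n" using w0 by eventually_elim simp
    qed (use wi in \<open>simp_all add: m.prob_space\<close>)
    also have "(\<integral>\<^sup>+\<theta>. ennreal (exp (- real n)) \<partial>\<nu>s) = ennreal (exp (- real n) * measure \<nu>s (space \<nu>s))"
      by (simp add: \<nu>s.emeasure_eq_measure ennreal_mult)
    also have "ennreal (1 + (\<integral>\<theta>. w \<theta> \<partial>?m) / n) + \<dots> = ennreal ?b"
      using integral_nonneg_AE[OF w0] by (subst ennreal_plus) auto
    finally show ?thesis
      using integral_nonneg_AE[OF w0] by (subst (asm) ennreal_le_iff) auto
  qed
  have "szego_infimum \<nu> = szego_infimum \<nu> * exp (\<integral>\<theta>. u \<theta> \<partial>?m) * exp (\<integral>\<theta>. ln (f \<theta>) \<partial>?m)"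
    by (simp add: iu flip: exp_add)
  also have "\<dots> \<le> ?b * exp (\<integral>\<theta>. ln (f \<theta>) \<partial>?m)"
    using ms bound by (intro mult_right_mono) auto
  finally show ?thesis by (simp add: f_def mult.commute)
qed

text \<open>Taking logarithms in the previous bound for a positive infimum controls the integral of the negative
  part of the logarithm of the clipped density. Fatou's lemma then shows in one step that the negative
  part of \<open>ln w\<close> is integrable and that the bound persists in the limit.\<close>

theorem szego_infimum_upper_bound:
  assumes \<nu>: "torus_measure \<nu>" and dec: "lebesgue_decomposition \<nu> w \<nu>s"
  shows "ereal (szego_infimum \<nu>) \<le> exp_ereal (ereal_integral torus_haar (\<lambda>\<theta>. log_ereal (w \<theta>)))"
proof (cases "szego_infimum \<nu> = 0")
  case True
  then show ?thesis using exp_ereal_nonneg by (simp add: zero_ereal_def[symmetric])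
next
  case False
  let ?m = "torus_haar" and ?S = "szego_infimum \<nu>"
  have S: "0 < ?S" using False szego_infimum_nonneg[of \<nu>] by simp
  interpret m: prob_space ?m by (rule prob_space_haar)
  have wi: "integrable ?m w" by (rule lebesgue_decomposition_integrable[OF \<nu> dec])
  have wm: "w \<in> borel_measurable ?m" and w0: "AE \<theta> in ?m. 0 \<le> w \<theta>"
    using dec by (auto simp: lebesgue_decomposition_def)
  define P where "P = (\<integral>\<theta>. ln_plus (w \<theta>) \<partial>?m)"
  define f where "f k \<theta> = min (max (w \<theta>) (1 / Suc k)) (Suc k)" for k \<theta>
  define b where "b k = 1 + (\<integral>\<theta>. w \<theta> \<partial>?m) / Suc k + exp (- real (Suc k)) * measure \<nu>s (space \<nu>s)" for k
  have b1: "1 \<le> b k" for k using integral_nonneg_AE[OF w0] by (simp add: b_def)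
  have fm: "(\<lambda>\<theta>. f k \<theta>) \<in> borel_measurable ?m" for k unfolding f_def using wm by measurable
  have f: "1 / Suc k \<le> f k \<theta>" "f k \<theta> \<le> Suc k" "0 < f k \<theta>" for k \<theta>
  proof -
    have n': "1 \<le> real (Suc k)" "1 / real (Suc k) \<le> 1" "0 < 1 / real (Suc k)" by auto
    show "1 / Suc k \<le> f k \<theta>" "f k \<theta> \<le> Suc k" "0 < f k \<theta>" unfolding f_def using n' by linarith+
  qed
  have lnf: "\<bar>ln (f k \<theta>)\<bar> \<le> ln (Suc k)" for k \<theta>
  proof -
    have "ln (f k \<theta>) \<le> ln (Suc k)" using f[of k \<theta>] by (intro ln_mono) auto
    moreover have "ln (1 / Suc k) \<le> ln (f k \<theta>)" using f[of k \<theta>] by (intro ln_mono) auto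
    ultimately show ?thesis by (simp add: ln_div abs_le_iff)
  qed
  have int: "integrable ?m (\<lambda>\<theta>. ln (f k \<theta>))" "integrable ?m (\<lambda>\<theta>. max 0 (- ln (f k \<theta>)))" for k
    using lnf fm[of k] by (auto intro!: m.integrable_const_bound[where B="ln (Suc k)"] split: split_max)
       (simp add: abs_le_iff)
  have q: "(\<integral>\<theta>. max 0 (- ln (f k \<theta>)) \<partial>?m) \<le> P + ln (b k) - ln ?S" for k
  proof -
    have "ln ?S \<le> ln (exp (\<integral>\<theta>. ln (f k \<theta>) \<partial>?m) * b k)"
      using szego_infimum_le_exp_clip[OF \<nu> dec, of "Suc k"] S by (intro ln_mono) (auto simp: f_def b_def)
    also have "\<dots> = (\<integral>\<theta>. ln (f k \<theta>) \<partial>?m) + ln (b k)"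
      using b1[of k] by (subst ln_mult) auto
    also have "(\<integral>\<theta>. ln (f k \<theta>) \<partial>?m) \<le> (\<integral>\<theta>. ln_plus (w \<theta>) - max 0 (- ln (f k \<theta>)) \<partial>?m)"
    proof (intro integral_mono)
      show "ln (f k \<theta>) \<le> ln_plus (w \<theta>) - max 0 (- ln (f k \<theta>))" for \<theta>
      proof (cases "1 < w \<theta>")
        case True
        moreover have "1 / real (Suc k) \<le> 1" by simp
        ultimately have "1 \<le> f k \<theta>" "f k \<theta> \<le> w \<theta>" unfolding f_def by linarith+
        then show ?thesis using True f(3)[of k \<theta>] by (auto simp: ln_plus_def)
      next
        case False
        moreover have "1 / real (Suc k) \<le> 1" by simp
        ultimately have "f k \<theta> \<le> 1" unfolding f_def by linarith
        then have "ln (f k \<theta>) \<le> 0" using f(3)[of k \<theta>] by simp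
        then show ?thesis by (simp add: max_def)
      qed
    qed (use int integrable_ln_plus[OF wi] in auto)
    also have "\<dots> = P - (\<integral>\<theta>. max 0 (- ln (f k \<theta>)) \<partial>?m)"
      using int integrable_ln_plus[OF wi] by (simp add: P_def)
    finally show ?thesis by simp
  qed
  have lim: "(\<lambda>k. ennreal (max 0 (- ln (f k \<theta>)))) \<longlonglongrightarrow> e2ennreal (- log_ereal (w \<theta>))" for \<theta>
  proof (cases "0 < w \<theta>")
    case True
    obtain K :: nat where K: "max (w \<theta>) (1 / w \<theta>) \<le> K" using real_arch_simple by blast
    have "f k \<theta> = w \<theta>" if "K \<le> k" for k
    proof -
      have "w \<theta> \<le> Suc k" "1 / w \<theta> \<le> Suc k" using K that by (auto intro: order_trans)
      then show ?thesis using True by (auto simp: f_def min_def max_def field_simps)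
    qed
    then have "\<forall>\<^sub>F k in sequentially. ennreal (max 0 (- ln (f k \<theta>))) = ennreal (- ln (w \<theta>))"
      unfolding eventually_sequentially by (intro exI[of _ K]) (simp add: max_def ennreal_neg)
    then show ?thesis using True by (simp add: e2ennreal_minus_log_ereal tendsto_eventually)
  next
    case False
    have "f k \<theta> = 1 / Suc k" for k
    proof -
      have "1 / real (Suc k) \<le> 1" "0 < 1 / real (Suc k)" "1 \<le> real (Suc k)" by auto
      then show ?thesis using False unfolding f_def by linarith
    qed
    then have "max 0 (- ln (f k \<theta>)) = ln (Suc k)" for k by (simp add: ln_div)
    moreover have "filterlim (\<lambda>k. ln (real (Suc k))) at_top sequentially"
      by (intro filterlim_compose[OF ln_at_top] filterlim_compose[OF filterlim_real_sequentially filterlim_Suc])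
    ultimately show ?thesis
      using False by (simp add: e2ennreal_minus_log_ereal ennreal_tendsto_top_eq_at_top)
  qed
  have limb: "(\<lambda>k. P + ln (b k) - ln ?S) \<longlonglongrightarrow> P + ln (1 + 0 + 0 * measure \<nu>s (space \<nu>s)) - ln ?S"
    unfolding b_def
  proof (intro tendsto_intros)
    show "(\<lambda>k. (\<integral>\<theta>. w \<theta> \<partial>?m) / real (Suc k)) \<longlonglongrightarrow> 0"
      by (rule LIMSEQ_Suc[OF lim_const_over_n])
    show "(\<lambda>k. exp (- real (Suc k))) \<longlonglongrightarrow> 0"
      by (intro filterlim_compose[OF exp_at_bot] filterlim_compose[OF filterlim_uminus_at_bot_at_top]
          filterlim_compose[OF filterlim_real_sequentially filterlim_Suc])
  qed simp
  have "(\<integral>\<^sup>+\<theta>. e2ennreal (- log_ereal (w \<theta>)) \<partial>?m)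
      = (\<integral>\<^sup>+\<theta>. liminf (\<lambda>k. ennreal (max 0 (- ln (f k \<theta>)))) \<partial>?m)"
    by (simp only: lim_imp_Liminf[OF sequentially_bot lim])
  also have "\<dots> \<le> liminf (\<lambda>k. \<integral>\<^sup>+\<theta>. ennreal (max 0 (- ln (f k \<theta>))) \<partial>?m)"
    by (intro nn_integral_liminf measurable_compose[OF borel_measurable_integrable[OF int(2)] measurable_ennreal])
  also have "\<dots> \<le> liminf (\<lambda>k. ennreal (P + ln (b k) - ln ?S))"
  proof (intro Liminf_mono always_eventually allI)
    show "(\<integral>\<^sup>+\<theta>. ennreal (max 0 (- ln (f k \<theta>))) \<partial>?m) \<le> ennreal (P + ln (b k) - ln ?S)" for k
      unfolding nn_integral_eq_integral[OF int(2) AE_I2[OF max.cobounded1]] by (rule ennreal_leI[OF q])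
  qed
  also have "\<dots> = ennreal (P - ln ?S)"
    using limb by (intro lim_imp_Liminf tendsto_ennrealI) auto
  finally have le: "(\<integral>\<^sup>+\<theta>. e2ennreal (- log_ereal (w \<theta>)) \<partial>?m) \<le> ennreal (P - ln ?S)" .
  have "0 \<le> P + ln (b k) - ln ?S" for k
    using q[of k] by (rule order_trans[rotated]) (auto intro!: Bochner_Integration.integral_nonneg)
  then have "0 \<le> P + ln (1 + 0 + 0 * measure \<nu>s (space \<nu>s)) - ln ?S"
    by (intro LIMSEQ_le_const[OF limb]) blast
  then have P: "0 \<le> P - ln ?S" by simp
  have "enn2ereal (\<integral>\<^sup>+\<theta>. e2ennreal (- log_ereal (w \<theta>)) \<partial>?m) \<le> ereal (P - ln ?S)"
    using le P by (metis enn2ereal_ennreal less_eq_ennreal.rep_eq)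
  then have "ereal (ln ?S) \<le> ereal P - enn2ereal (\<integral>\<^sup>+\<theta>. e2ennreal (- log_ereal (w \<theta>)) \<partial>?m)"
    by (cases "enn2ereal (\<integral>\<^sup>+\<theta>. e2ennreal (- log_ereal (w \<theta>)) \<partial>?m)") auto
  then have "ereal (ln ?S) \<le> ereal_integral ?m (\<lambda>\<theta>. log_ereal (w \<theta>))"
    by (simp add: ereal_integral_log[OF wi] P_def)
  then have "exp_ereal (ereal (ln ?S)) \<le> exp_ereal (ereal_integral ?m (\<lambda>\<theta>. log_ereal (w \<theta>)))"
    by (rule exp_ereal_mono)
  then show ?thesis using S by simp
qed

section \<open>The lower bound in Szego's theorem\<close>

text \<open>Jensen's inequality for the exponential, obtained by integrating its tangent line at the mean \<open>c\<close> of
  \<open>ln w\<close>. When the negative part of \<open>ln w\<close> is not integrable, the left-hand side is zero.\<close>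

lemma jensen_exp_log:
  assumes "prob_space M" and u: "integrable M u" "(\<integral>x. u x \<partial>M) = 0"
    and w: "integrable M w" "AE x in M. 0 \<le> w x" and uw: "integrable M (\<lambda>x. exp (u x) * w x)"
  shows "exp_ereal (ereal_integral M (\<lambda>x. log_ereal (w x))) \<le> ereal (\<integral>x. exp (u x) * w x \<partial>M)"
proof -
  interpret prob_space M by fact
  have wm [measurable]: "w \<in> borel_measurable M" using w(1) by auto
  let ?L = "\<integral>\<^sup>+x. e2ennreal (- log_ereal (w x)) \<partial>M"
  have nn: "0 \<le> (\<integral>x. exp (u x) * w x \<partial>M)"
    using w(2) by (intro integral_nonneg_AE) auto
  show ?thesis
  proof (cases "?L = \<top>")
    case True
    then show ?thesis using nn by (simp add: ereal_integral_log[OF w(1)])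
  next
    case False
    have "AE x in M. e2ennreal (- log_ereal (w x)) \<noteq> \<infinity>"
      using False by (intro nn_integral_PInf_AE) auto
    then have pos: "AE x in M. 0 < w x"
      by eventually_elim (auto simp: e2ennreal_minus_log_ereal split: if_splits)
    define r where "r x = max 0 (- ln (w x))" for x
    have rm [measurable]: "r \<in> borel_measurable M" unfolding r_def by measurable
    have L: "?L = (\<integral>\<^sup>+x. ennreal (r x) \<partial>M)"
    proof (rule nn_integral_cong_AE)
      show "AE x in M. e2ennreal (- log_ereal (w x)) = ennreal (r x)"
        using pos by eventually_elim (auto simp: e2ennreal_minus_log_ereal r_def max_def ennreal_neg)
    qed
    have ri: "integrable M r"
      by (rule integrableI_nonneg) (use False L in \<open>auto simp: r_def less_top\<close>)
    have Lr: "?L = ennreal (\<integral>x. r x \<partial>M)"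
      unfolding L by (rule nn_integral_eq_integral[OF ri]) (simp add: r_def)
    have pi: "integrable M (\<lambda>x. ln_plus (w x))" by (rule integrable_ln_plus[OF w(1)])
    define c where "c = (\<integral>x. ln_plus (w x) \<partial>M) - (\<integral>x. r x \<partial>M)"
    have "0 \<le> (\<integral>x. r x \<partial>M)" by (simp add: r_def)
    then have eint: "ereal_integral M (\<lambda>x. log_ereal (w x)) = ereal c"
      by (simp add: ereal_integral_log[OF w(1)] Lr c_def enn2ereal_ennreal)
    have "exp c = (\<integral>x. exp c * (1 + u x + (ln_plus (w x) - r x) - c) \<partial>M)"
      using u pi ri by (simp add: prob_space c_def)
    also have "\<dots> \<le> (\<integral>x. exp (u x) * w x \<partial>M)"
    proof (rule integral_mono_AE)
      show "AE x in M. exp c * (1 + u x + (ln_plus (w x) - r x) - c) \<le> exp (u x) * w x"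
        using pos
      proof eventually_elim
        fix x assume x: "0 < w x"
        have l: "ln_plus (w x) - r x = ln (w x)"
          using x by (auto simp: ln_plus_def r_def max_def)
        \<comment> \<open>The tangent line of \<open>exp\<close> at \<open>c\<close>, evaluated at \<open>u x + ln (w x)\<close>.\<close>
        have "exp c * (1 + (u x + ln (w x) - c)) \<le> exp c * exp (u x + ln (w x) - c)"
          by (intro mult_left_mono exp_ge_add_one_self) auto
        also have "\<dots> = exp (u x + ln (w x))" by (simp flip: exp_add)
        also have "\<dots> = exp (u x) * w x" using x by (simp add: exp_add)
        finally show "exp c * (1 + u x + (ln_plus (w x) - r x) - c) \<le> exp (u x) * w x"
          unfolding l by (simp add: algebra_simps)
      qed
    qed (use u pi ri uw in auto)
    finally show ?thesis by (simp add: eint)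
  qed
qed

text \<open>In the unit disc \<open>ln \<bar>1 - z\<bar>\<close> is the real part of a power series without constant term, so its means
  over circles around the origin vanish.\<close>

lemma haar_integral_ln_cmod_one_minus:
  assumes c: "cmod c < 1"
  shows "integrable torus_haar (\<lambda>\<theta>. ln (cmod (1 - c * cis \<theta>)))"
    and "(\<integral>\<theta>. ln (cmod (1 - c * cis \<theta>)) \<partial>torus_haar) = 0"
proof -
  interpret prob_space torus_haar by (rule prob_space_haar)
  define Q where "Q N = (\<Sum>n<N. monom (- (c ^ n) / of_nat n) n)" for N
  have poly_Q: "poly (Q N) z = (\<Sum>n<N. - ((c * z) ^ n) / of_nat n)" for N z
    by (simp add: Q_def poly_sum poly_monom power_mult_distrib)
  \<comment> \<open>The term for \<open>n = 0\<close> is a quotient by zero, hence zero.\<close>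
  have Q0: "poly (Q N) 0 = 0" for N
    by (auto simp: poly_Q power_0_left intro!: sum.neutral)
  have lt: "cmod (c * cis \<theta>) < 1" for \<theta> using c by (simp add: norm_mult)
  have meas: "(\<lambda>\<theta>. ln (cmod (1 - c * cis \<theta>))) \<in> borel_measurable torus_haar"
    using measurable_cis_torus_measure[OF torus_measure_haar] by measurable
  have Qi: "integrable torus_haar (\<lambda>\<theta>. poly (Q N) (cis \<theta>))" for N
    using integrable_torus_continuous[OF torus_measure_haar, of "poly (Q N)"]
    by (simp add: continuous_intros)
  have lim: "(\<lambda>N. Re (poly (Q N) (cis \<theta>))) \<longlonglongrightarrow> ln (cmod (1 - c * cis \<theta>))" for \<theta>
  proof -
    have "(\<lambda>N. poly (Q N) (cis \<theta>)) \<longlonglongrightarrow> Ln (1 - c * cis \<theta>)"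
      using Ln_series'[of "- (c * cis \<theta>)"] lt[of \<theta>] unfolding poly_Q sums_def by simp
    then have "(\<lambda>N. Re (poly (Q N) (cis \<theta>))) \<longlonglongrightarrow> Re (Ln (1 - c * cis \<theta>))"
      by (rule tendsto_Re)
    moreover have "1 - c * cis \<theta> \<noteq> 0" using lt[of \<theta>] by auto
    ultimately show ?thesis by simp
  qed
  have bound: "\<bar>Re (poly (Q N) (cis \<theta>))\<bar> \<le> 1 / (1 - cmod c)" for N \<theta>
  proof -
    have "\<bar>Re (poly (Q N) (cis \<theta>))\<bar> \<le> cmod (poly (Q N) (cis \<theta>))" by (rule abs_Re_le_cmod)
    also have "\<dots> \<le> (\<Sum>n<N. cmod (- ((c * cis \<theta>) ^ n) / of_nat n))" unfolding poly_Q by (rule norm_sum)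
    also have "\<dots> \<le> (\<Sum>n<N. cmod c ^ n)"
    proof (rule sum_mono)
      fix n
      have "cmod c ^ n / real n \<le> cmod c ^ n"
        by (cases n) (auto simp: field_simps)
      then show "cmod (- ((c * cis \<theta>) ^ n) / of_nat n) \<le> cmod c ^ n"
        by (simp add: norm_divide norm_mult norm_power)
    qed
    also have "\<dots> \<le> (\<Sum>n. cmod c ^ n)" using c by (intro sum_le_suminf summable_geometric) auto
    also have "\<dots> = 1 / (1 - cmod c)" using c by (simp add: suminf_geometric)
    finally show ?thesis .
  qed
  have 1: "AE \<theta> in torus_haar. (\<lambda>N. Re (poly (Q N) (cis \<theta>))) \<longlonglongrightarrow> ln (cmod (1 - c * cis \<theta>))"
    using lim by (intro AE_I2)
  have 2: "AE \<theta> in torus_haar. norm (Re (poly (Q N) (cis \<theta>))) \<le> 1 / (1 - cmod c)" for N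
    unfolding real_norm_def using bound by (intro AE_I2)
  have 3: "(\<lambda>\<theta>. Re (poly (Q N) (cis \<theta>))) \<in> borel_measurable torus_haar" for N
    using integrable_Re[OF Qi] by (rule borel_measurable_integrable)
  have 4: "integrable torus_haar (\<lambda>_. 1 / (1 - cmod c))" by simp
  show "integrable torus_haar (\<lambda>\<theta>. ln (cmod (1 - c * cis \<theta>)))"
    by (rule integrable_dominated_convergence[OF meas 3 4 1 2])
  have "(\<integral>\<theta>. Re (poly (Q N) (cis \<theta>)) \<partial>torus_haar) = 0" for N
    using Qi by (simp add: integral_haar_poly Q0)
  then have "(\<lambda>N. 0) \<longlonglongrightarrow> (\<integral>\<theta>. ln (cmod (1 - c * cis \<theta>)) \<partial>torus_haar)"
    using integral_dominated_convergence[OF meas 3 4 1 2] by simp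
  then show "(\<integral>\<theta>. ln (cmod (1 - c * cis \<theta>)) \<partial>torus_haar) = 0"
    by (rule LIMSEQ_unique[OF tendsto_const, symmetric])
qed

text \<open>A root \<open>b\<close> inside the unit disc is reflected to \<open>1 / cnj b\<close>: on the circle this divides the modulus by
  \<open>1 / \<bar>b\<bar>\<close>, which is at least 1, and it preserves the value at the origin.\<close>

lemma poly_ge_prod_reflected_roots:
  fixes p :: "complex poly"
  assumes "poly p 0 = 1"
  shows "\<exists>cs. (\<forall>c\<in>set cs. cmod c \<le> 1) \<and>
    (\<forall>z. cmod z = 1 \<longrightarrow> cmod (\<Prod>c\<leftarrow>cs. 1 - c * z) \<le> cmod (poly p z))"
  using assms
proof (induction "degree p" arbitrary: p rule: less_induct)
  case less
  show ?case
  proof (cases "degree p = 0")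
    case True
    then obtain a where "p = [:a:]" by (rule degree_eq_zeroE)
    then show ?thesis using less.prems by (intro exI[of _ "[]"]) auto
  next
    case False
    then obtain b where b: "poly p b = 0"
      using fundamental_theorem_of_algebra constant_degree by metis
    then obtain r where r: "p = [:- b, 1:] * r" by (auto simp: poly_eq_0_iff_dvd dvd_def)
    have b0: "b \<noteq> 0" using b less.prems by auto
    have "r \<noteq> 0" using r less.prems by auto
    then have deg: "degree (smult (- b) r) < degree p"
      unfolding r using b0 by (subst degree_mult_eq) auto
    have "poly (smult (- b) r) 0 = 1" using less.prems r by simp
    from less.hyps[OF deg this] obtain cs where cs: "\<And>c. c \<in> set cs \<Longrightarrow> cmod c \<le> 1"
      "\<And>z. cmod z = 1 \<Longrightarrow> cmod (\<Prod>c\<leftarrow>cs. 1 - c * z) \<le> cmod (poly (smult (- b) r) z)" by blast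
    \<comment> \<open>The factor \<open>1 - c z\<close> has the root \<open>b\<close>, or its reflection if \<open>b\<close> lies in the disc.\<close>
    define c where "c = (if cmod b < 1 then cnj b else 1 / b)"
    have c1: "cmod c \<le> 1" by (auto simp: c_def norm_divide divide_le_eq_1)
    have c2: "cmod (1 - c * z) \<le> cmod (1 - z / b)" if z: "cmod z = 1" for z
    proof (cases "cmod b < 1")
      case True
      have "cmod (1 - c * z) = cmod (z * cnj (z - b))"
        using True z complex_norm_square[of z] by (simp add: c_def algebra_simps)
      also have "\<dots> = cmod (b - z)" using z by (simp only: norm_mult complex_mod_cnj mult_1_left norm_minus_commute)
      also have "\<dots> \<le> cmod (b - z) / cmod b" using True b0 by (simp add: field_simps mult_left_le_one_le)
      also have "\<dots> = cmod (1 - z / b)" using b0 by (simp add: diff_divide_distrib flip: norm_divide)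
      finally show ?thesis .
    qed (simp add: c_def)
    show ?thesis
    proof (intro exI[of _ "c # cs"] conjI allI impI ballI)
      fix z :: complex assume z: "cmod z = 1"
      have "cmod (\<Prod>c\<leftarrow>c # cs. 1 - c * z) \<le> cmod (1 - z / b) * cmod (poly (smult (- b) r) z)"
        using c2[OF z] cs(2)[OF z] by (simp add: norm_mult mult_mono)
      also have "\<dots> = cmod (poly p z)"
      proof -
        have "(1 - z / b) * poly (smult (- b) r) z = poly p z"
          using b0 by (simp add: r field_simps)
        then show ?thesis by (simp only: norm_mult[symmetric])
      qed
      finally show "cmod (\<Prod>c\<leftarrow>c # cs. 1 - c * z) \<le> cmod (poly p z)" .
    qed (use c1 cs in auto)
  qed
qed

lemma exp_sum_ln_eq_prod:
  assumes "\<And>c. c \<in> set cs \<Longrightarrow> cmod c < 1" "cmod z = 1"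
  shows "exp (\<Sum>c\<leftarrow>cs. 2 * ln (cmod (1 - c * z))) = (cmod (\<Prod>c\<leftarrow>cs. 1 - c * z))\<^sup>2"
  using assms(1)
proof (induction cs)
  case (Cons c cs)
  have "cmod (c * z) < 1" using Cons.prems assms(2) by (simp add: norm_mult)
  then have "1 - c * z \<noteq> 0" by auto
  then have "exp (2 * ln (cmod (1 - c * z))) = (cmod (1 - c * z))\<^sup>2" by (simp add: exp_double)
  then show ?case using Cons by (simp add: exp_add norm_mult power_mult_distrib)
qed simp

text \<open>A product without zeros in the closed disc has logarithmic modulus of mean zero, so Jensen's inequality
  bounds the integral of its square against \<open>w dm\<close>; the singular part can only increase the integral.\<close>

lemma exp_log_integral_le_prod:
  assumes \<nu>: "torus_measure \<nu>" and dec: "lebesgue_decomposition \<nu> w \<nu>s"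
    and cs: "\<And>c. c \<in> set cs \<Longrightarrow> cmod c < 1"
  shows "exp_ereal (ereal_integral torus_haar (\<lambda>\<theta>. log_ereal (w \<theta>)))
    \<le> ereal (\<integral>\<theta>. (cmod (\<Prod>c\<leftarrow>cs. 1 - c * cis \<theta>))\<^sup>2 \<partial>\<nu>)"
proof -
  let ?m = torus_haar
  let ?P = "\<lambda>\<theta>. (cmod (\<Prod>c\<leftarrow>cs. 1 - c * cis \<theta>))\<^sup>2"
  have wm: "w \<in> borel_measurable ?m" and w0: "AE \<theta> in ?m. 0 \<le> w \<theta>"
    using dec by (auto simp: lebesgue_decomposition_def)
  have wi: "integrable ?m w" by (rule lebesgue_decomposition_integrable[OF \<nu> dec])
  define u where "u \<theta> = (\<Sum>c\<leftarrow>cs. 2 * ln (cmod (1 - c * cis \<theta>)))" for \<theta>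
  have "integrable ?m u \<and> (\<integral>\<theta>. u \<theta> \<partial>?m) = 0"
    unfolding u_def using cs
    by (induction cs) (auto simp: haar_integral_ln_cmod_one_minus)
  then have u: "integrable ?m u" "(\<integral>\<theta>. u \<theta> \<partial>?m) = 0" by auto
  have expu: "exp (u \<theta>) = ?P \<theta>" for \<theta> unfolding u_def by (rule exp_sum_ln_eq_prod[OF cs]) auto
  have cont: "continuous_on UNIV (\<lambda>z. (cmod (\<Prod>c\<leftarrow>cs. 1 - c * z))\<^sup>2)"
  proof -
    have "continuous_on UNIV (\<lambda>z. \<Prod>c\<leftarrow>cs. 1 - c * z)"
      by (induction cs) (auto intro!: continuous_intros)
    then show ?thesis by (intro continuous_intros)
  qed
  have Pi: "integrable \<nu> ?P" by (rule integrable_torus_continuous[OF \<nu> cont])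
  have Pm: "?P \<in> borel_measurable ?m"
    using integrable_torus_continuous[OF torus_measure_haar cont] by auto
  have le: "(\<integral>\<^sup>+\<theta>. ennreal (exp (u \<theta>) * w \<theta>) \<partial>?m) \<le> ennreal (\<integral>\<theta>. ?P \<theta> \<partial>\<nu>)"
  proof -
    have "(\<integral>\<^sup>+\<theta>. ennreal (exp (u \<theta>) * w \<theta>) \<partial>?m) = (\<integral>\<^sup>+\<theta>. ennreal (w \<theta>) * ennreal (?P \<theta>) \<partial>?m)"
    proof (rule nn_integral_cong_AE)
      show "AE \<theta> in ?m. ennreal (exp (u \<theta>) * w \<theta>) = ennreal (w \<theta>) * ennreal (?P \<theta>)"
        using w0
      proof eventually_elim
        case (elim \<theta>)
        then show ?case unfolding expu by (subst ennreal_mult[symmetric]) (auto simp: mult.commute)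
      qed
    qed
    also have "\<dots> \<le> (\<integral>\<^sup>+\<theta>. ennreal (?P \<theta>) \<partial>\<nu>)"
      using lebesgue_decomposition_nn_integral[OF \<nu> dec, of "\<lambda>\<theta>. ennreal (?P \<theta>)"] Pi by simp
    also have "\<dots> = ennreal (\<integral>\<theta>. ?P \<theta> \<partial>\<nu>)" using Pi by (intro nn_integral_eq_integral) auto
    finally show ?thesis .
  qed
  have uw: "integrable ?m (\<lambda>\<theta>. exp (u \<theta>) * w \<theta>)"
  proof (rule integrableI_nonneg)
    show "(\<lambda>\<theta>. exp (u \<theta>) * w \<theta>) \<in> borel_measurable ?m"
      unfolding expu using Pm wm by (rule borel_measurable_times)
    show "AE \<theta> in ?m. 0 \<le> exp (u \<theta>) * w \<theta>" using w0 by eventually_elim simp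
    show "(\<integral>\<^sup>+\<theta>. ennreal (exp (u \<theta>) * w \<theta>) \<partial>?m) < \<infinity>"
      using le by (rule le_less_trans) simp
  qed
  have "exp_ereal (ereal_integral ?m (\<lambda>\<theta>. log_ereal (w \<theta>))) \<le> ereal (\<integral>\<theta>. exp (u \<theta>) * w \<theta> \<partial>?m)"
    by (rule jensen_exp_log[OF prob_space_haar u wi w0 uw])
  also have "(\<integral>\<theta>. exp (u \<theta>) * w \<theta> \<partial>?m) \<le> (\<integral>\<theta>. ?P \<theta> \<partial>\<nu>)"
  proof -
    have nn: "AE \<theta> in ?m. 0 \<le> exp (u \<theta>) * w \<theta>" using w0 by eventually_elim simp
    show ?thesis
      using le unfolding nn_integral_eq_integral[OF uw nn] by simp
  qed
  finally show ?thesis by simp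
qed

text \<open>Reflecting the roots leaves a product whose zeros may still lie on the circle. Shrinking the
  coefficients by \<open>r < 1\<close> moves them outside, and \<open>r\<close> tends to 1 by dominated convergence.\<close>

theorem szego_infimum_lower_bound:
  assumes \<nu>: "torus_measure \<nu>" and dec: "lebesgue_decomposition \<nu> w \<nu>s"
  shows "exp_ereal (ereal_integral torus_haar (\<lambda>\<theta>. log_ereal (w \<theta>))) \<le> ereal (szego_infimum \<nu>)"
    (is "?G \<le> _")
proof -
  interpret \<nu>: finite_measure \<nu> using \<nu> by (simp add: torus_measure_def)
  have *: "?G \<le> ereal (\<integral>\<theta>. (cmod (poly p (cis \<theta>)))\<^sup>2 \<partial>\<nu>)" if p0: "poly p 0 = 1" for p
  proof -
    obtain cs where cs: "\<And>c. c \<in> set cs \<Longrightarrow> cmod c \<le> 1"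
      "\<And>z. cmod z = 1 \<Longrightarrow> cmod (\<Prod>c\<leftarrow>cs. 1 - c * z) \<le> cmod (poly p z)"
      using poly_ge_prod_reflected_roots[OF p0] by blast
    define F where "F r z = (cmod (\<Prod>c\<leftarrow>cs. 1 - (of_real r * c) * z))\<^sup>2" for r z
    have contF: "continuous_on UNIV (F r)" for r
    proof -
      have "continuous_on UNIV (\<lambda>z. \<Prod>c\<leftarrow>cs. 1 - (of_real r * c) * z)"
        by (induction cs) (auto intro!: continuous_intros)
      then show ?thesis unfolding F_def by (intro continuous_intros)
    qed
    have Fi: "integrable \<nu> (\<lambda>\<theta>. F r (cis \<theta>))" for r by (rule integrable_torus_continuous[OF \<nu> contF])
    define r where "r k = real k / real (Suc k)" for k
    have r: "0 \<le> r k" "r k < 1" for k by (auto simp: r_def)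
    have G: "?G \<le> ereal (\<integral>\<theta>. F (r k) (cis \<theta>) \<partial>\<nu>)" for k
    proof -
      have "cmod (of_real (r k) * c) < 1" if "c \<in> set cs" for c
        using cs(1)[OF that] r[of k] by (simp add: norm_mult) (metis mult_left_le le_less_trans)
      then show ?thesis
        using exp_log_integral_le_prod[OF \<nu> dec, of "map (\<lambda>c. of_real (r k) * c) cs"]
        by (auto simp: F_def o_def)
    qed
    have "(\<lambda>k. \<integral>\<theta>. F (r k) (cis \<theta>) \<partial>\<nu>) \<longlonglongrightarrow> (\<integral>\<theta>. F 1 (cis \<theta>) \<partial>\<nu>)"
    proof (rule integral_dominated_convergence[where w="\<lambda>_. (2 ^ length cs)\<^sup>2"])
      have r1: "r \<longlonglongrightarrow> 1" unfolding r_def by (rule LIMSEQ_n_over_Suc_n)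
      have "(\<lambda>k. \<Prod>c\<leftarrow>cs. 1 - (of_real (r k) * c) * z) \<longlonglongrightarrow> (\<Prod>c\<leftarrow>cs. 1 - (of_real 1 * c) * z)" for z
      proof (induction cs)
        case (Cons c cs)
        then show ?case unfolding list.map prod_list.Cons using r1 by (intro tendsto_intros)
      qed simp
      then show "AE \<theta> in \<nu>. (\<lambda>k. F (r k) (cis \<theta>)) \<longlonglongrightarrow> F 1 (cis \<theta>)"
        unfolding F_def by (intro AE_I2 tendsto_intros)
      have "cmod (\<Prod>c\<leftarrow>cs. 1 - (of_real (r k) * c) * cis \<theta>) \<le> 2 ^ length cs" for k \<theta>
        using cs(1)
      proof (induction cs)
        case (Cons c cs)
        have "cmod (1 - (of_real (r k) * c) * cis \<theta>) \<le> 1 + r k * cmod c"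
          using norm_triangle_ineq4[of 1 "(of_real (r k) * c) * cis \<theta>"] r[of k] by (simp add: norm_mult)
        also have "\<dots> \<le> 1 + 1 * 1" using Cons.prems r[of k] by (intro add_left_mono mult_mono) auto
        finally show ?case using Cons by (simp add: norm_mult mult_mono)
      qed simp
      then show "AE \<theta> in \<nu>. norm (F (r k) (cis \<theta>)) \<le> (2 ^ length cs)\<^sup>2" for k
        unfolding F_def by (intro AE_I2) (simp add: power_mono)
    qed (use Fi in \<open>auto simp: borel_measurable_integrable\<close>)
    then have "?G \<le> ereal (\<integral>\<theta>. F 1 (cis \<theta>) \<partial>\<nu>)"
      using G by (intro LIMSEQ_le_const[OF tendsto_ereal]) auto
    also have "(\<integral>\<theta>. F 1 (cis \<theta>) \<partial>\<nu>) \<le> (\<integral>\<theta>. (cmod (poly p (cis \<theta>)))\<^sup>2 \<partial>\<nu>)"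
    proof (rule integral_mono[OF Fi])
      show "integrable \<nu> (\<lambda>\<theta>. (cmod (poly p (cis \<theta>)))\<^sup>2)"
        by (rule integrable_torus_continuous[OF \<nu>]) (intro continuous_intros)
    qed (use cs(2) in \<open>auto simp: F_def intro!: power_mono\<close>)
    finally show ?thesis by simp
  qed
  have "?G \<noteq> \<infinity>" using *[of 1] by auto
  then obtain g where g: "?G = ereal g" using exp_ereal_nonneg by (cases ?G) auto
  have "g \<le> szego_infimum \<nu>"
    unfolding szego_infimum_def using * g by (intro cINF_greatest) (auto intro: exI[of _ 1])
  then show ?thesis by (simp add: g)
qed

section \<open>From the tree to the circle\<close>

lemma fourier_coeff_minus: "fourier_coeff \<nu> (- k) = cnj (fourier_coeff \<nu> k)"
proof -
  have "(\<lambda>\<theta>. exp (- \<i> * of_int (- k) * of_real \<theta>)) = (\<lambda>\<theta>. cnj (exp (- \<i> * of_int k * of_real \<theta>)))"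
    by (simp add: exp_cnj)
  then show ?thesis unfolding fourier_coeff_def by (simp only: Bochner_Integration.integral_cnj)
qed

lemma cis_power_L2:
  assumes "torus_measure \<nu>"
  shows "(\<lambda>\<theta>. cis \<theta> ^ n) \<in> L2_carrier \<nu>"
  using assms integrable_torus_continuous[OF assms, of "\<lambda>z. (cmod (z ^ n))\<^sup>2"]
    measurable_cis_torus_measure[OF assms]
  by (auto simp: L2_carrier_def continuous_intros)

lemma Cov_cis_power:
  "Cov \<nu> (\<lambda>\<theta>. cis \<theta> ^ n) (\<lambda>\<theta>. cis \<theta> ^ m) = fourier_coeff \<nu> (int m - int n)"
  unfolding Cov_def fourier_coeff_def
proof (rule Bochner_Integration.integral_cong[OF refl])
  fix \<theta>
  have "cis \<theta> ^ n * cnj (cis \<theta> ^ m) = cis (real n * \<theta> + - (real m * \<theta>))"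
    by (simp only: Complex.DeMoivre cis_cnj cis_mult)
  then show "cis \<theta> ^ n * cnj (cis \<theta> ^ m) = exp (- \<i> * of_int (int m - int n) * of_real \<theta>)"
    by (simp add: cis_conv_exp algebra_simps)
qed

definition level :: "nat \<Rightarrow> nat \<Rightarrow> nat list set" where
  "level q n = {\<sigma> \<in> words q. length \<sigma> = n}"

lemma level_altdef: "level q n = {xs. set xs \<subseteq> {..<q} \<and> length xs = n}"
  by (auto simp: level_def words_def)

lemma finite_level [simp]: "finite (level q n)"
  unfolding level_altdef by (rule finite_lists_length_eq) simp

lemma card_level: "card (level q n) = q ^ n"
  unfolding level_altdef by (subst card_lists_length_eq) auto

lemma append_in_words_iff: "\<sigma> @ \<tau> \<in> words q \<longleftrightarrow> \<sigma> \<in> words q \<and> \<tau> \<in> words q"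
  by (auto simp: words_def)

text \<open>The measure \<open>\<nu>\<close> is the one with \<open>q\<^sup>n\<^sup>/\<^sup>2\<close>-scaled coefficients; covariances are expressed through it
  because it is the spectral measure of the radial variables.\<close>

locale branching_process =
  fixes q :: nat and M :: "'a measure" and X :: "nat list \<Rightarrow> 'a \<Rightarrow> complex" and \<nu> :: "real measure"
  assumes q_pos: "0 < q"
    and X_L2: "\<sigma> \<in> words q \<Longrightarrow> X \<sigma> \<in> L2_carrier M"
    and Cov_append: "\<sigma> \<in> words q \<Longrightarrow> \<tau> \<in> words q \<Longrightarrow> Cov M (X \<sigma>) (X (\<sigma> @ \<tau>))
      = of_real (real q powr (- real (length \<tau>) / 2)) * fourier_coeff \<nu> (int (length \<tau>))"
    and Cov_incomparable:
      "\<sigma> \<in> words q \<Longrightarrow> \<tau> \<in> words q \<Longrightarrow> \<not> comparable \<sigma> \<tau> \<Longrightarrow> Cov M (X \<sigma>) (X \<tau>) = 0"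
    and torus_nu: "torus_measure \<nu>"
begin

text \<open>The normalisation makes the variance independent of \<open>n\<close>, since a level has \<open>q ^ n\<close> uncorrelated
  members.\<close>

definition radial :: "nat \<Rightarrow> 'a \<Rightarrow> complex" where
  "radial n \<omega> = (\<Sum>\<sigma>\<in>level q n. of_real (real q powr (- real n / 2)) * X \<sigma> \<omega>)"

lemma radial_L2: "radial n \<in> L2_carrier M"
  unfolding radial_def[abs_def] by (intro L2_carrier_lincomb X_L2) (simp add: level_def)

text \<open>A word has \<open>q ^ k\<close> descendants \<open>k\<close> levels below and a single ancestor \<open>k\<close> levels above. With the factor
  \<open>q powr (- k / 2)\<close> of the covariance this gives \<open>q powr (k / 2)\<close> and \<open>q powr (- k / 2)\<close>, hence one
  formula for both directions.\<close>

lemma sum_Cov_level: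
  assumes \<sigma>: "\<sigma> \<in> words q"
  shows "(\<Sum>\<tau>\<in>level q m. Cov M (X \<sigma>) (X \<tau>))
    = of_real (real q powr ((real m - real (length \<sigma>)) / 2)) * fourier_coeff \<nu> (int m - int (length \<sigma>))"
proof (cases "length \<sigma> \<le> m")
  case True
  let ?k = "m - length \<sigma>"
  have sub: "(@) \<sigma> ` level q ?k \<subseteq> level q m"
    using \<sigma> True by (auto simp: level_def append_in_words_iff)
  have "(\<Sum>\<tau>\<in>level q m. Cov M (X \<sigma>) (X \<tau>)) = (\<Sum>\<tau>\<in>(@) \<sigma> ` level q ?k. Cov M (X \<sigma>) (X \<tau>))"
  proof (rule sum.mono_neutral_right[OF finite_level sub], rule ballI)
    fix \<tau> assume \<tau>: "\<tau> \<in> level q m - (@) \<sigma> ` level q ?k"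
    have "\<not> prefix \<sigma> \<tau>"
      using \<tau> by (auto simp: prefix_def level_def append_in_words_iff)
    moreover have "\<not> prefix \<tau> \<sigma>"
    proof
      assume "prefix \<tau> \<sigma>"
      moreover have "length \<sigma> \<le> length \<tau>" using \<tau> True by (auto simp: level_def)
      ultimately have "\<tau> = \<sigma>" by (auto simp: prefix_def)
      with \<open>\<not> prefix \<sigma> \<tau>\<close> show False by simp
    qed
    ultimately show "Cov M (X \<sigma>) (X \<tau>) = 0"
      using \<sigma> \<tau> by (intro Cov_incomparable) (auto simp: comparable_def level_def)
  qed
  also have "\<dots> = (\<Sum>\<tau>\<in>level q ?k. Cov M (X \<sigma>) (X (\<sigma> @ \<tau>)))"
    by (subst sum.reindex) (auto simp: inj_on_def)
  also have "\<dots> = (\<Sum>\<tau>\<in>level q ?k. of_real (real q powr (- real ?k / 2)) * fourier_coeff \<nu> (int ?k))"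
    using \<sigma> by (intro sum.cong refl) (simp add: Cov_append level_def)
  also have "\<dots> = of_real (real q powr real ?k * real q powr (- real ?k / 2)) * fourier_coeff \<nu> (int ?k)"
    using q_pos by (simp add: card_level powr_realpow)
  also have "real q powr real ?k * real q powr (- real ?k / 2)
      = real q powr ((real m - real (length \<sigma>)) / 2)"
    using True by (simp add: of_nat_diff field_simps flip: powr_add)
  finally show ?thesis using True by (simp add: of_nat_diff)
next
  case False
  let ?\<tau> = "take m \<sigma>" and ?\<delta> = "drop m \<sigma>"
  have w: "?\<tau> \<in> words q" "?\<delta> \<in> words q"
    using \<sigma> append_in_words_iff[of ?\<tau> ?\<delta> q] by simp_all
  have mem: "?\<tau> \<in> level q m" using w False by (simp add: level_def)
  have "(\<Sum>\<tau>\<in>level q m. Cov M (X \<sigma>) (X \<tau>)) = (\<Sum>\<tau>\<in>{?\<tau>}. Cov M (X \<sigma>) (X \<tau>))"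
  proof (rule sum.mono_neutral_right[OF finite_level], use mem in simp, rule ballI)
    fix \<tau> assume \<tau>: "\<tau> \<in> level q m - {?\<tau>}"
    have "\<not> prefix \<tau> \<sigma>" using \<tau> by (auto simp: prefix_def level_def)
    moreover have "\<not> prefix \<sigma> \<tau>" using \<tau> False by (auto simp: prefix_def level_def)
    ultimately show "Cov M (X \<sigma>) (X \<tau>) = 0"
      using \<sigma> \<tau> by (intro Cov_incomparable) (auto simp: comparable_def level_def)
  qed
  also have "\<dots> = cnj (Cov M (X ?\<tau>) (X (?\<tau> @ ?\<delta>)))"
    by (simp add: Cov_commute[of M "X \<sigma>"])
  also have "\<dots> = of_real (real q powr (- real (length \<sigma> - m) / 2))
      * fourier_coeff \<nu> (- int (length \<sigma> - m))"
    by (simp only: Cov_append[OF w] complex_cnj_mult complex_cnj_complex_of_real fourier_coeff_minus length_drop)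
  finally show ?thesis using False by (simp add: of_nat_diff)
qed

text \<open>The value depends on \<open>\<sigma>\<close> only through its length, which is why averaging over levels is an orthogonal
  projection.\<close>

lemma Cov_X_radial:
  assumes \<sigma>: "\<sigma> \<in> words q"
  shows "Cov M (X \<sigma>) (radial m)
    = of_real (real q powr (- real (length \<sigma>) / 2)) * fourier_coeff \<nu> (int m - int (length \<sigma>))"
proof -
  have "Cov M (X \<sigma>) (radial m)
      = of_real (real q powr (- real m / 2)) * (\<Sum>\<tau>\<in>level q m. Cov M (X \<sigma>) (X \<tau>))"
    unfolding radial_def[abs_def]
    by (subst Cov_lincomb_right) (auto intro!: X_L2 \<sigma> simp: level_def sum_distrib_left)
  also have "\<dots> = of_real (real q powr (- real m / 2) * real q powr ((real m - real (length \<sigma>)) / 2))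
      * fourier_coeff \<nu> (int m - int (length \<sigma>))"
    by (simp add: sum_Cov_level[OF \<sigma>])
  also have "real q powr (- real m / 2) * real q powr ((real m - real (length \<sigma>)) / 2)
      = real q powr (- real (length \<sigma>) / 2)"
    by (simp add: field_simps flip: powr_add)
  finally show ?thesis .
qed

lemma Cov_radial: "Cov M (radial n) (radial m) = fourier_coeff \<nu> (int m - int n)"
proof -
  have "Cov M (radial n) (radial m)
      = (\<Sum>\<sigma>\<in>level q n. of_real (real q powr (- real n / 2)) * Cov M (X \<sigma>) (radial m))"
    unfolding radial_def[of n, abs_def]
    by (subst Cov_lincomb_left) (auto intro!: X_L2 radial_L2 simp: level_def)
  also have "\<dots> = (\<Sum>\<sigma>\<in>level q n. of_real (real q powr (- real n / 2) * real q powr (- real n / 2))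
      * fourier_coeff \<nu> (int m - int n))"
    by (intro sum.cong refl) (simp add: Cov_X_radial level_def)
  also have "\<dots> = of_real (real q powr real n * real q powr (- real n)) * fourier_coeff \<nu> (int m - int n)"
    using q_pos by (simp add: card_level powr_realpow flip: powr_add)
  also have "real q powr real n * real q powr (- real n) = 1"
    using q_pos by (simp flip: powr_add)
  finally show ?thesis by simp
qed

text \<open>The spectral isometry that sends \<open>radial n\<close> to the \<open>n\<close>-th power of the coordinate on the circle.\<close>

lemma L2_norm_radial_lincomb:
  "(\<integral>\<omega>. (cmod (\<Sum>n\<le>N. d n * radial n \<omega>))\<^sup>2 \<partial>M) = (\<integral>\<theta>. (cmod (\<Sum>n\<le>N. d n * cis \<theta> ^ n))\<^sup>2 \<partial>\<nu>)"
proof -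
  have "Cov M (\<lambda>\<omega>. \<Sum>n\<le>N. d n * radial n \<omega>) (\<lambda>\<omega>. \<Sum>n\<le>N. d n * radial n \<omega>)
      = Cov \<nu> (\<lambda>\<theta>. \<Sum>n\<le>N. d n * cis \<theta> ^ n) (\<lambda>\<theta>. \<Sum>n\<le>N. d n * cis \<theta> ^ n)"
    by (simp add: Cov_lincomb_left Cov_lincomb_right radial_L2 cis_power_L2 torus_nu
        L2_carrier_lincomb Cov_radial Cov_cis_power)
  then show ?thesis unfolding Cov_self of_real_eq_iff .
qed

text \<open>Averaging the coefficients over each level projects onto the radial variables, so it does not increase
  the norm.\<close>

lemma radial_projection:
  assumes B: "finite B" "B \<subseteq> words q" "\<And>\<sigma>. \<sigma> \<in> B \<Longrightarrow> length \<sigma> \<le> N"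
    and d: "\<And>n. d n = (\<Sum>\<sigma>\<in>{\<sigma>\<in>B. length \<sigma> = n}. a \<sigma> * of_real (real q powr (- real n / 2)))"
  shows "(\<integral>\<theta>. (cmod (\<Sum>n\<le>N. d n * cis \<theta> ^ n))\<^sup>2 \<partial>\<nu>) \<le> (\<integral>\<omega>. (cmod (\<Sum>\<sigma>\<in>B. a \<sigma> * X \<sigma> \<omega>))\<^sup>2 \<partial>M)"
proof -
  let ?R = "\<lambda>\<omega>. \<Sum>n\<le>N. d n * radial n \<omega>" and ?Z = "\<lambda>\<omega>. \<Sum>\<sigma>\<in>B. a \<sigma> * X \<sigma> \<omega>"
  have Z: "?Z \<in> L2_carrier M" using B by (intro L2_carrier_lincomb X_L2) auto
  have R: "?R \<in> L2_carrier M" by (intro L2_carrier_lincomb radial_L2)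
  have "Cov M ?Z (radial m) = Cov M ?R (radial m)" for m
  proof -
    have "Cov M ?Z (radial m) = (\<Sum>\<sigma>\<in>B. a \<sigma> * of_real (real q powr (- real (length \<sigma>) / 2))
        * fourier_coeff \<nu> (int m - int (length \<sigma>)))"
      using B by (subst Cov_lincomb_left)
        (auto intro!: X_L2 radial_L2 sum.cong simp: Cov_X_radial subset_iff)
    also have "\<dots> = (\<Sum>n\<le>N. \<Sum>\<sigma>\<in>{\<sigma>\<in>B. length \<sigma> = n}. a \<sigma> * of_real (real q powr (- real (length \<sigma>) / 2))
        * fourier_coeff \<nu> (int m - int (length \<sigma>)))"
      using B by (intro sum.group[symmetric]) auto
    also have "\<dots> = (\<Sum>n\<le>N. d n * fourier_coeff \<nu> (int m - int n))"
      by (intro sum.cong refl) (simp add: d sum_distrib_right)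
    also have "\<dots> = Cov M ?R (radial m)"
      by (simp add: Cov_lincomb_left radial_L2 Cov_radial)
    finally show ?thesis .
  qed
  then have "Cov M ?Z ?R = Cov M ?R ?R"
    using Cov_lincomb_right[of "{..N}" radial M _ d] radial_L2 Z R by simp
  then have "(\<integral>\<omega>. (cmod (?R \<omega>))\<^sup>2 \<partial>M) \<le> (\<integral>\<omega>. (cmod (?Z \<omega>))\<^sup>2 \<partial>M)"
    by (rule L2_norm_projection_le[OF Z R])
  then show ?thesis by (simp only: L2_norm_radial_lincomb)
qed

text \<open>Projection onto the radial variables turns a combination that has coefficient 1 at the root and
  involves arbitrary other words into a polynomial with constant coefficient 1; conversely every such
  polynomial comes from a radial combination.\<close>

theorem L2_infdist_eq_sqrt_szego_infimum:
  "L2_infdist M (X []) (L2_closure M (complex_span (X ` (words q - {[]})))) = sqrt (szego_infimum \<nu>)"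
proof -
  let ?V = "complex_span (X ` (words q - {[]}))"
  have Nil: "[] \<in> words q" by (simp add: words_def)
  have V: "?V \<subseteq> L2_carrier M"
  proof
    fix g assume "g \<in> ?V"
    then obtain B c where "B \<subseteq> words q - {[]}" "g = (\<lambda>\<omega>. \<Sum>\<sigma>\<in>B. c \<sigma> * X \<sigma> \<omega>)"
      unfolding complex_span_image by blast
    then show "g \<in> L2_carrier M" by (auto intro!: L2_carrier_lincomb X_L2)
  qed
  have V0: "?V \<noteq> {}" unfolding complex_span_image by blast
  have bdd: "bdd_below (L2_dist M (X []) ` ?V)" using L2_dist_nonneg by (intro bdd_belowI2) auto
  have "L2_infdist M (X []) ?V = sqrt (szego_infimum \<nu>)"
  proof (rule antisym)
    show "sqrt (szego_infimum \<nu>) \<le> L2_infdist M (X []) ?V"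
      unfolding L2_infdist_def
    proof (rule cINF_greatest[OF V0])
      fix g assume "g \<in> ?V"
      then obtain B c where B: "finite B" "B \<subseteq> words q - {[]}" "g = (\<lambda>\<omega>. \<Sum>\<sigma>\<in>B. c \<sigma> * X \<sigma> \<omega>)"
        unfolding complex_span_image by blast
      define a where "a \<sigma> = (if \<sigma> = [] then 1 else - c \<sigma>)" for \<sigma>
      define d where "d n = (\<Sum>\<sigma>\<in>{\<sigma>\<in>insert [] B. length \<sigma> = n}. a \<sigma> * of_real (real q powr (- real n / 2)))" for n
      define N where "N = Max (length ` insert [] B)"
      define p where "p = (\<Sum>n\<le>N. monom (d n) n)"
      have poly_p: "poly p z = (\<Sum>n\<le>N. d n * z ^ n)" for z by (simp add: p_def poly_sum poly_monom)
      have "{\<sigma> \<in> insert [] B. length \<sigma> = 0} = {[]}" by auto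
      then have "d 0 = 1" using q_pos by (simp add: d_def a_def)
      then have "poly p 0 = 1"
        by (simp add: poly_p power_0_left if_distrib[of "\<lambda>x. _ * x"] sum.delta cong: if_cong)
      then have "szego_infimum \<nu> \<le> (\<integral>\<theta>. (cmod (\<Sum>n\<le>N. d n * cis \<theta> ^ n))\<^sup>2 \<partial>\<nu>)"
        unfolding poly_p[symmetric] by (rule szego_infimum_le)
      also have "\<dots> \<le> (\<integral>\<omega>. (cmod (\<Sum>\<sigma>\<in>insert [] B. a \<sigma> * X \<sigma> \<omega>))\<^sup>2 \<partial>M)"
        using B Nil by (intro radial_projection) (auto simp: d_def N_def)
      also have "(\<lambda>\<omega>. \<Sum>\<sigma>\<in>insert [] B. a \<sigma> * X \<sigma> \<omega>) = (\<lambda>\<omega>. X [] \<omega> - g \<omega>)"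
      proof
        fix \<omega>
        have "[] \<notin> B" using B by auto
        then have "(\<Sum>\<sigma>\<in>insert [] B. a \<sigma> * X \<sigma> \<omega>) = X [] \<omega> + (\<Sum>\<sigma>\<in>B. a \<sigma> * X \<sigma> \<omega>)"
          using B(1) by (simp add: a_def)
        also have "(\<Sum>\<sigma>\<in>B. a \<sigma> * X \<sigma> \<omega>) = - g \<omega>"
          unfolding B(3) sum_negf[symmetric] using \<open>[] \<notin> B\<close> by (intro sum.cong) (auto simp: a_def)
        finally show "(\<Sum>\<sigma>\<in>insert [] B. a \<sigma> * X \<sigma> \<omega>) = X [] \<omega> - g \<omega>" by simp
      qed
      finally show "sqrt (szego_infimum \<nu>) \<le> L2_dist M (X []) g"
        unfolding L2_dist_def by (intro real_sqrt_le_mono) (simp add: fun_eq_iff)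
    qed
    have "(L2_infdist M (X []) ?V)\<^sup>2 \<le> szego_infimum \<nu>"
      unfolding szego_infimum_def
    proof (rule cINF_greatest)
      show "{p. poly p 0 = (1::complex)} \<noteq> {}" by (auto intro: exI[of _ 1])
      fix p :: "complex poly" assume "p \<in> {p. poly p 0 = 1}"
      then have p0: "coeff p 0 = 1" by (simp add: poly_0_coeff_0)
      let ?N = "degree p"
      define T where "T = {\<sigma> \<in> words q. length \<sigma> \<le> ?N}"
      have T: "finite T"
      proof -
        have "T = (\<Union>n\<le>?N. level q n)" by (auto simp: T_def level_def)
        then show ?thesis by simp
      qed
      define b where "b \<sigma> = coeff p (length \<sigma>) * of_real (real q powr (- real (length \<sigma>) / 2))" for \<sigma> :: "nat list"
      define g where "g = (\<lambda>\<omega>. \<Sum>\<sigma>\<in>T - {[]}. - b \<sigma> * X \<sigma> \<omega>)"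
      have "g \<in> ?V"
        unfolding complex_span_image g_def using T
        by (intro CollectI exI[of _ "T - {[]}"] exI[of _ "\<lambda>\<sigma>. - b \<sigma>"]) (auto simp: T_def)
      then have "L2_infdist M (X []) ?V \<le> L2_dist M (X []) g"
        unfolding L2_infdist_def by (rule cINF_lower[OF bdd])
      moreover have "0 \<le> L2_infdist M (X []) ?V"
        unfolding L2_infdist_def using L2_dist_nonneg by (intro cINF_greatest[OF V0])
      ultimately have "(L2_infdist M (X []) ?V)\<^sup>2 \<le> (\<integral>\<omega>. (cmod (X [] \<omega> - g \<omega>))\<^sup>2 \<partial>M)"
        unfolding L2_dist_power2[symmetric] by (intro power_mono)
      also have "(\<lambda>\<omega>. X [] \<omega> - g \<omega>) = (\<lambda>\<omega>. \<Sum>n\<le>?N. coeff p n * radial n \<omega>)"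
      proof
        fix \<omega>
        have "(\<Sum>n\<le>?N. coeff p n * radial n \<omega>) = (\<Sum>n\<le>?N. \<Sum>\<sigma>\<in>{\<sigma>\<in>T. length \<sigma> = n}. b \<sigma> * X \<sigma> \<omega>)"
        proof (rule sum.cong[OF refl])
          fix n assume "n \<in> {..?N}"
          then have "{\<sigma> \<in> T. length \<sigma> = n} = level q n" by (auto simp: T_def level_def)
          then show "coeff p n * radial n \<omega> = (\<Sum>\<sigma>\<in>{\<sigma>\<in>T. length \<sigma> = n}. b \<sigma> * X \<sigma> \<omega>)"
            by (auto simp: radial_def b_def sum_distrib_left level_def intro!: sum.cong)
        qed
        also have "\<dots> = (\<Sum>\<sigma>\<in>T. b \<sigma> * X \<sigma> \<omega>)"
          using T by (intro sum.group) (auto simp: T_def)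
        also have "\<dots> = b [] * X [] \<omega> + (\<Sum>\<sigma>\<in>T - {[]}. b \<sigma> * X \<sigma> \<omega>)"
          using T Nil by (intro sum.remove) (auto simp: T_def)
        also have "\<dots> = X [] \<omega> - g \<omega>"
          using q_pos by (simp add: b_def g_def p0 sum_negf)
        finally show "X [] \<omega> - g \<omega> = (\<Sum>n\<le>?N. coeff p n * radial n \<omega>)" by simp
      qed
      then have "(\<integral>\<omega>. (cmod (X [] \<omega> - g \<omega>))\<^sup>2 \<partial>M) = (\<integral>\<omega>. (cmod (\<Sum>n\<le>?N. coeff p n * radial n \<omega>))\<^sup>2 \<partial>M)"
        by (simp add: fun_eq_iff)
      also have "\<dots> = (\<integral>\<theta>. (cmod (poly p (cis \<theta>)))\<^sup>2 \<partial>\<nu>)"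
        by (simp only: L2_norm_radial_lincomb poly_altdef)
      finally show "(L2_infdist M (X []) ?V)\<^sup>2 \<le> (\<integral>\<theta>. (cmod (poly p (cis \<theta>)))\<^sup>2 \<partial>\<nu>)" .
    qed
    then show "L2_infdist M (X []) ?V \<le> sqrt (szego_infimum \<nu>)" by (rule real_le_rsqrt)
  qed
  then show ?thesis using L2_infdist_closure[OF X_L2[OF Nil] V V0] by simp
qed

end

section \<open>The prediction error at the root\<close>

lemma exp_ereal_half:
  assumes "ereal s = exp_ereal x"
  shows "ereal (sqrt s) = exp_ereal (ereal (1 / 2) * x)"
proof (cases x)
  case (real r)
  have "sqrt (exp r) = exp (r / 2)"
    by (rule real_sqrt_unique) (auto simp flip: exp_double)
  then show ?thesis using assms real by simp
qed (use assms in auto)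

theorem theorem1p10:
  fixes q :: nat
    and M :: "'a measure"
    and X :: "nat list \<Rightarrow> 'a \<Rightarrow> complex"
    and \<mu>X \<nu>\<alpha> \<nu>s :: "real measure"
    and \<alpha> :: "nat \<Rightarrow> complex"
    and w :: "real \<Rightarrow> real"
  assumes "q \<ge> 2"
    and "prob_space M"
    and "branching_stationary q M X"
    and "common_spectral_measure q M X \<mu>X"
    and "\<And>k. \<alpha> k = fourier_coeff \<mu>X (int k)"
    and "torus_measure \<nu>\<alpha>"
    and "\<And>n. fourier_coeff \<nu>\<alpha> (int n) = of_real (real q powr (real n / 2)) * \<alpha> n"
    and "lebesgue_decomposition \<nu>\<alpha> w \<nu>s"
  shows "ereal (L2_infdist M (X []) (L2_closure M (complex_span (X ` (words q - {[]})))))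
       = exp_ereal (ereal (1 / 2) * ereal_integral torus_haar (\<lambda>\<theta>. log_ereal (w \<theta>)))"
proof -
  have q: "0 < q" using assms(1) by simp
  interpret branching_process q M X \<nu>\<alpha>
  proof
    show "0 < q" by (rule q)
    show "X \<sigma> \<in> L2_carrier M" if "\<sigma> \<in> words q" for \<sigma>
      using assms(3) that by (auto simp: branching_stationary_def mean_zero_L2_def)
    show "Cov M (X \<sigma>) (X \<tau>) = 0" if "\<sigma> \<in> words q" "\<tau> \<in> words q" "\<not> comparable \<sigma> \<tau>" for \<sigma> \<tau>
      using assms(3) that by (auto simp: branching_stationary_def)
    show "Cov M (X \<sigma>) (X (\<sigma> @ \<tau>))
        = of_real (real q powr (- real (length \<tau>) / 2)) * fourier_coeff \<nu>\<alpha> (int (length \<tau>))"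
      if "\<sigma> \<in> words q" "\<tau> \<in> words q" for \<sigma> \<tau>
    proof -
      have "real q powr (- real (length \<tau>) / 2) * real q powr (real (length \<tau>) / 2) = 1"
        using q by (simp flip: powr_add)
      then have "of_real (real q powr (- real (length \<tau>) / 2)) * fourier_coeff \<nu>\<alpha> (int (length \<tau>))
          = \<alpha> (length \<tau>)"
        unfolding assms(7) mult.assoc[symmetric] of_real_mult[symmetric] by simp
      then show ?thesis
        using branching_stationary_Cov(1)[OF q assms(3,4) that] assms(5) by simp
    qed
    show "torus_measure \<nu>\<alpha>" by (rule assms(6))
  qed
  have "ereal (szego_infimum \<nu>\<alpha>) = exp_ereal (ereal_integral torus_haar (\<lambda>\<theta>. log_ereal (w \<theta>)))"
    using szego_infimum_upper_bound[OF assms(6,8)] szego_infimum_lower_bound[OF assms(6,8)]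
    by (rule antisym)
  then show ?thesis
    unfolding L2_infdist_eq_sqrt_szego_infimum by (rule exp_ereal_half)
qed

end
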